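(* Let $n\in\mathbb N$, $m>0$, and $W(\lambda)=\sum_{q=0}^pC_q\lambda^{q+1}$ with $p\in\mathbb N$, $C_q\in\mathbb R$, $C_p>0$. 1. There is $\tau_0>0$ such that for any $\tau\in(0,\tau_0)$ (with $\varepsilon=\sqrt n\,\tau$) and all $(u^0,u^1)\in\mathscr X$ the Cauchy problem for (KG) with $(\psi^0,\psi^1)=(u^0,u^1)$ has a unique solution $\psi\in\ell^\infty(\mathbb Z,\ell^2(\mathbb Z^n))$. Moreover, for such $\tau$: 2. The value of the energy functional is conserved: $E^T=E^0$ for all $T\in\mathbb Z$. 3. $\psi$ satisfies the a priori estimate $$\varepsilon^n\|\psi^T\|_{\ell^2}^2\le\frac4{m^2}\Big[E^0-\inf_{\lambda\ge0}W(\lambda)\Big],\qquad T\in\mathbb Z.$$ 4. For each $T\in\mathbb Z$, the map $U(T):(u^0,u^1)\mapsto(\psi^T,\psi^{T+1})$ is continuous in $\mathscr X$. 5. For each $T\in\mathbb Z$, the map $U(T):(u^0,u^1)\mapsto(\psi^T,\psi^{T+1})$ is weakly continuous in $\mathscr X$.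
   Context: $\mathbb N=\{1,2,\dots\}$. The time step $\tau>0$ and the space step $\varepsilon>0$ satisfy $\tau/\varepsilon=1/\sqrt n$. For $\psi:\mathbb Z^n\times\mathbb Z\to\mathbb C$, $(X,T)\mapsto\psi_X^T$, write $\psi^T=(\psi_X^T)_{X\in\mathbb Z^n}$, $$D_T^2\psi_X^T=\psi_X^{T+1}-2\psi_X^T+\psi_X^{T-1},\qquad \mathbf D_X^2\psi_X^T=\sum_{j=1}^n(\psi_{X+e_j}^T-2\psi_X^T+\psi_{X-e_j}^T),$$ with $e_j$ the standard basis vectors of $\mathbb Z^n$, and $$b^T[\psi]=\begin{cases}\dfrac{W(|\psi_0^{T+1}|^2)-W(|\psi_0^{T-1}|^2)}{|\psi_0^{T+1}|^2-|\psi_0^{T-1}|^2},&|\psi_0^{T+1}|\ne|\psi_0^{T-1}|,\\ W'(|\psi_0^{T+1}|^2),&|\psi_0^{T+1}|=|\psi_0^{T-1}|.\end{cases}$$ The equation (KG) is $$D_T^2\psi_X^T-\tfrac1n\mathbf D_X^2\psi_X^T+\tau^2m^2\,\tfrac{\psi_X^{T+1}+\psi_X^{T-1}}2=-\tau^2\delta_{X,0}\,b^T[\psi]\,\tfrac{\psi_0^{T+1}+\psi_0^{T-1}}2,\qquad X\in\mathbb Z^n,\ T\in\mathbb Z.$$ Phase space: $\mathscr X=\ell^2(\mathbb Z^n)\times\ell^2(\mathbb Z^n)$ with $\|(u,v)\|_{\mathscr X}^2=\|u\|_{\ell^2}^2+\|v\|_{\ell^2}^2$. The discrete energy at the moment $T$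 is $$E^T=\sum_{X\in\mathbb Z^n}\varepsilon^n\Big[\sum_{j=1}^n\frac{|\psi_X^{T+1}-\psi_{X-e_j}^T|^2+|\psi_X^{T+1}-\psi_{X+e_j}^T|^2}{4n\tau^2}+m^2\frac{|\psi_X^{T+1}|^2+|\psi_X^T|^2}4\Big]+\varepsilon^n\,\frac{W(|\psi_0^{T+1}|^2)+W(|\psi_0^T|^2)}4.$$ *)

theory Defs
  imports "HOL-Analysis.Analysis"
begin

section \<open>The Hilbert space of square-summable families\<close>

typedef 'a ell2 = "{u :: 'a \<Rightarrow> complex. (\<lambda>x. (cmod (u x))\<^sup>2) summable_on UNIV}"
  morphisms coord Abs_ell2
  by (rule exI[of _ "\<lambda>_. 0"]) simp

setup_lifting type_definition_ell2

lemma cmod_add_sq_le: "(cmod (a + b))\<^sup>2 \<le> 2 * (cmod a)\<^sup>2 + 2 * (cmod b)\<^sup>2"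
proof -
  have "(cmod (a + b))\<^sup>2 \<le> (cmod a + cmod b)\<^sup>2"
    by (intro power_mono norm_triangle_ineq norm_ge_zero)
  also have "\<dots> \<le> 2 * (cmod a)\<^sup>2 + 2 * (cmod b)\<^sup>2"
    using sum_squares_bound[of "cmod a" "cmod b"] by (simp add: power2_sum)
  finally show ?thesis .
qed

lemma square_summable_add:
  assumes "(\<lambda>x. (cmod (u x))\<^sup>2) summable_on A" "(\<lambda>x. (cmod (v x))\<^sup>2) summable_on A"
  shows "(\<lambda>x. (cmod (u x + v x))\<^sup>2) summable_on A"
proof (rule summable_on_comparison_test)
  show "(\<lambda>x. 2 * (cmod (u x))\<^sup>2 + 2 * (cmod (v x))\<^sup>2) summable_on A"
    by (intro summable_on_add summable_on_cmult_right assms)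
qed (simp_all add: cmod_add_sq_le)

lemma square_summable_cmult:
  assumes "(\<lambda>x. (cmod (u x))\<^sup>2) summable_on A"
  shows "(\<lambda>x. (cmod (c * u x))\<^sup>2) summable_on A"
  unfolding norm_mult power_mult_distrib
  by (intro summable_on_cmult_right assms)

lift_definition cscale :: "complex \<Rightarrow> 'a ell2 \<Rightarrow> 'a ell2" is "\<lambda>c u x. c * u x"
  by (rule square_summable_cmult)

instantiation ell2 :: (type) real_vector
begin
lift_definition zero_ell2 :: "'a ell2" is "\<lambda>_. 0" by simp
lift_definition plus_ell2 :: "'a ell2 \<Rightarrow> 'a ell2 \<Rightarrow> 'a ell2" is "\<lambda>u v x. u x + v x"
  by (rule square_summable_add)
lift_definition uminus_ell2 :: "'a ell2 \<Rightarrow> 'a ell2" is "\<lambda>u x. - u x" by simp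
lift_definition minus_ell2 :: "'a ell2 \<Rightarrow> 'a ell2 \<Rightarrow> 'a ell2" is "\<lambda>u v x. u x - v x"
  subgoal for u v using square_summable_add[of u UNIV "\<lambda>x. - v x"] by simp
  done
lift_definition scaleR_ell2 :: "real \<Rightarrow> 'a ell2 \<Rightarrow> 'a ell2" is "\<lambda>r u x. complex_of_real r * u x"
  by (rule square_summable_cmult)
instance
  by standard (transfer; simp add: fun_eq_iff algebra_simps)+
end

lemma ell2_norm_triangle:
  fixes u v :: "'a \<Rightarrow> complex"
  assumes u: "(\<lambda>x. (cmod (u x))\<^sup>2) summable_on UNIV"
    and v: "(\<lambda>x. (cmod (v x))\<^sup>2) summable_on UNIV"
  shows "sqrt (\<Sum>\<^sub>\<infinity>x. (cmod (u x + v x))\<^sup>2)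
    \<le> sqrt (\<Sum>\<^sub>\<infinity>x. (cmod (u x))\<^sup>2) + sqrt (\<Sum>\<^sub>\<infinity>x. (cmod (v x))\<^sup>2)" (is "_ \<le> ?N u + ?N v")
proof -
  have N0: "0 \<le> ?N w" for w :: "'a \<Rightarrow> complex"
    by (simp add: infsum_nonneg)
  have L2: "L2_set (\<lambda>x. cmod (w x)) F \<le> ?N w"
    if "finite F" "(\<lambda>x. (cmod (w x))\<^sup>2) summable_on UNIV" for F and w :: "'a \<Rightarrow> complex"
    unfolding L2_set_def using that
    by (intro real_sqrt_le_mono finite_sum_le_infsum) auto
  have "(\<Sum>\<^sub>\<infinity>x. (cmod (u x + v x))\<^sup>2) \<le> (?N u + ?N v)\<^sup>2"
  proof (rule infsum_le_finite_sums[OF square_summable_add[OF u v]])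
    fix F :: "'a set" assume F: "finite F"
    have "L2_set (\<lambda>x. cmod (u x + v x)) F \<le> L2_set (\<lambda>x. cmod (u x) + cmod (v x)) F"
      by (intro L2_set_mono norm_triangle_ineq) auto
    also have "\<dots> \<le> L2_set (\<lambda>x. cmod (u x)) F + L2_set (\<lambda>x. cmod (v x)) F"
      by (rule L2_set_triangle_ineq)
    also have "\<dots> \<le> ?N u + ?N v"
      by (intro add_mono L2 F u v)
    finally have "sqrt (\<Sum>x\<in>F. (cmod (u x + v x))\<^sup>2) \<le> ?N u + ?N v"
      by (simp add: L2_set_def)
    then show "(\<Sum>x\<in>F. (cmod (u x + v x))\<^sup>2) \<le> (?N u + ?N v)\<^sup>2"
      by (rule sqrt_le_D)
  qed
  then show ?thesis
    using N0 by (intro real_le_lsqrt) (auto intro: add_nonneg_nonneg)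
qed

instantiation ell2 :: (type) real_normed_vector
begin
lift_definition norm_ell2 :: "'a ell2 \<Rightarrow> real" is "\<lambda>u. sqrt (\<Sum>\<^sub>\<infinity>x. (cmod (u x))\<^sup>2)" .
definition dist_ell2 :: "'a ell2 \<Rightarrow> 'a ell2 \<Rightarrow> real" where "dist_ell2 u v = norm (u - v)"
definition sgn_ell2 :: "'a ell2 \<Rightarrow> 'a ell2" where "sgn_ell2 u = inverse (norm u) *\<^sub>R u"
definition uniformity_ell2 :: "('a ell2 \<times> 'a ell2) filter"
  where "uniformity_ell2 = (INF e\<in>{0<..}. principal {(u, v). dist u v < e})"
definition open_ell2 :: "'a ell2 set \<Rightarrow> bool"
  where "open_ell2 S = (\<forall>u\<in>S. \<forall>\<^sub>F (u', v) in uniformity. u' = u \<longrightarrow> v \<in> S)"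
instance
proof
  fix u v :: "'a ell2" and r :: real
  show "(norm u = 0) = (u = 0)"
  proof transfer
    fix u :: "'a \<Rightarrow> complex"
    assume "(\<lambda>x. (cmod (u x))\<^sup>2) summable_on UNIV"
    then have "u x = 0" if "(\<Sum>\<^sub>\<infinity>x. (cmod (u x))\<^sup>2) = 0" for x
      using nonneg_infsum_le_0D[of "\<lambda>x. (cmod (u x))\<^sup>2" UNIV x] that by simp
    then show "(sqrt (\<Sum>\<^sub>\<infinity>x. (cmod (u x))\<^sup>2) = 0) = (u = (\<lambda>_. 0))"
      unfolding fun_eq_iff real_sqrt_eq_0_iff by (intro iffI allI) simp_all
  qed
  show "norm (u + v) \<le> norm u + norm v"
    by transfer (rule ell2_norm_triangle)
  show "norm (r *\<^sub>R u) = \<bar>r\<bar> * norm u"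
    by transfer
      (simp add: norm_mult power_mult_distrib infsum_cmult_right' real_sqrt_mult)
qed (simp_all add: dist_ell2_def sgn_ell2_def uniformity_ell2_def open_ell2_def)
end

section \<open>The discrete equation\<close>

text \<open>The lattice is \<open>int ^ 'n\<close> with \<open>n = CARD('n)\<close>; the basis vector \<open>e\<^sub>j\<close> is \<open>axis j 1\<close>.\<close>

definition DT2 :: "(int \<Rightarrow> int ^ 'n \<Rightarrow> complex) \<Rightarrow> int \<Rightarrow> int ^ 'n \<Rightarrow> complex" where
  "DT2 \<psi> T X = \<psi> (T + 1) X - 2 * \<psi> T X + \<psi> (T - 1) X"

definition DX2 :: "(int \<Rightarrow> int ^ 'n \<Rightarrow> complex) \<Rightarrow> int \<Rightarrow> int ^ 'n \<Rightarrow> complex" where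
  "DX2 \<psi> T X = (\<Sum>j\<in>UNIV. \<psi> T (X + axis j 1) - 2 * \<psi> T X + \<psi> T (X - axis j 1))"

definition bterm :: "(real \<Rightarrow> real) \<Rightarrow> (int \<Rightarrow> int ^ 'n \<Rightarrow> complex) \<Rightarrow> int \<Rightarrow> real" where
  "bterm W \<psi> T =
    (if cmod (\<psi> (T + 1) 0) \<noteq> cmod (\<psi> (T - 1) 0)
     then (W ((cmod (\<psi> (T + 1) 0))\<^sup>2) - W ((cmod (\<psi> (T - 1) 0))\<^sup>2))
          / ((cmod (\<psi> (T + 1) 0))\<^sup>2 - (cmod (\<psi> (T - 1) 0))\<^sup>2)
     else deriv W ((cmod (\<psi> (T + 1) 0))\<^sup>2))"

definition KG :: "(real \<Rightarrow> real) \<Rightarrow> real \<Rightarrow> real \<Rightarrow> (int \<Rightarrow> int ^ 'n \<Rightarrow> complex) \<Rightarrow> bool" where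
  "KG W m \<tau> \<psi> \<longleftrightarrow>
    (\<forall>X T. DT2 \<psi> T X - 1 / of_nat CARD('n) * DX2 \<psi> T X
        + of_real (\<tau>\<^sup>2 * m\<^sup>2) * ((\<psi> (T + 1) X + \<psi> (T - 1) X) / 2)
      = - of_real (\<tau>\<^sup>2) * (if X = 0 then 1 else 0) * of_real (bterm W \<psi> T)
        * ((\<psi> (T + 1) 0 + \<psi> (T - 1) 0) / 2))"

text \<open>The sum converges whenever the slices \<open>\<psi> T\<close> and \<open>\<psi> (T + 1)\<close> are square summable, as they are for
  elements of \<open>ell2\<close>.\<close>

definition energy ::
    "(real \<Rightarrow> real) \<Rightarrow> real \<Rightarrow> real \<Rightarrow> real \<Rightarrow> (int \<Rightarrow> int ^ 'n \<Rightarrow> complex) \<Rightarrow> int \<Rightarrow> real" where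
  "energy W m \<tau> \<epsilon> \<psi> T =
    (\<Sum>\<^sub>\<infinity>X. \<epsilon> ^ CARD('n) *
      ((\<Sum>j\<in>UNIV. ((cmod (\<psi> (T + 1) X - \<psi> T (X - axis j 1)))\<^sup>2
                  + (cmod (\<psi> (T + 1) X - \<psi> T (X + axis j 1)))\<^sup>2)
                 / (4 * real CARD('n) * \<tau>\<^sup>2))
       + m\<^sup>2 * (((cmod (\<psi> (T + 1) X))\<^sup>2 + (cmod (\<psi> T X))\<^sup>2) / 4)))
    + \<epsilon> ^ CARD('n) * ((W ((cmod (\<psi> (T + 1) 0))\<^sup>2) + W ((cmod (\<psi> T 0))\<^sup>2)) / 4)"

section \<open>The Cauchy problem and its propagator\<close>

text \<open>The product norm on \<open>phase\<close> is the norm \<open>sqrt ((norm u)\<^sup>2 + (norm v)\<^sup>2)\<close> of the phase space.\<close>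

type_synonym 'n phase = "(int ^ 'n) ell2 \<times> (int ^ 'n) ell2"

definition cauchy_solution ::
    "(real \<Rightarrow> real) \<Rightarrow> real \<Rightarrow> real \<Rightarrow> 'n::finite phase \<Rightarrow> (int \<Rightarrow> (int ^ 'n) ell2) \<Rightarrow> bool" where
  "cauchy_solution W m \<tau> u \<psi> \<longleftrightarrow>
    bounded (range \<psi>) \<and> KG W m \<tau> (\<lambda>T. coord (\<psi> T)) \<and> (\<psi> 0, \<psi> 1) = u"

text \<open>Only meaningful when the Cauchy problem is uniquely solvable for every initial datum.\<close>

definition propagator ::
    "(real \<Rightarrow> real) \<Rightarrow> real \<Rightarrow> real \<Rightarrow> int \<Rightarrow> 'n::finite phase \<Rightarrow> 'n phase" where
  "propagator W m \<tau> T u = (let \<psi> = (THE \<psi>. cauchy_solution W m \<tau> u \<psi>) in (\<psi> T, \<psi> (T + 1)))"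

section \<open>The weak topology of the phase space\<close>

text \<open>Continuous functionals that are linear over the complex numbers; \<open>bounded_linear\<close> alone
  gives linearity over the reals only.\<close>

definition phase_functional :: "('n::finite phase \<Rightarrow> complex) \<Rightarrow> bool" where
  "phase_functional f \<longleftrightarrow>
    bounded_linear f \<and> (\<forall>c u v. f (cscale c u, cscale c v) = c * f (u, v))"

definition weak_topology :: "'n::finite phase topology" where
  "weak_topology = topology_generated_by {f -` S |f S. phase_functional f \<and> open S}"

end

theory Submission
  imports Defs
begin

text \<open>
  With \<open>a = 1 + \<tau>\<^sup>2 * m\<^sup>2 / 2\<close> and \<open>average\<close> the mean over the neighbouring lattice points, the equation
  says that \<open>a\<close> times the sum of the new and the old slice is the average of the current slice, up to a
  term supported at the origin. Away from the origin the new slice is therefore explicit, and at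
  the origin there remains one scalar equation \<open>\<kappa> w z * w = g\<close> for the sum \<open>w\<close> of the new and the
  old value, whose real coefficient \<open>\<kappa>\<close> contains the divided difference of \<open>W\<close>. As \<open>\<kappa>\<close> is real,
  the equation can be studied on the ray through \<open>g\<close>. There the derivative of the nonlinear part is
  bounded below, uniformly in the old value \<open>z\<close> (\<open>radial_divdiff_derivative_bounded_below\<close>); so for
  small \<open>\<tau>\<close> the left-hand side increases strictly and the equation has exactly one
  solution, which depends continuously on the data (\<open>radial_map_continuous_inverse\<close>).

  The equation is symmetric in the new and the old slice, so the same step runs backwards in time, and
  the solution of the Cauchy problem is the orbit of a two-sided flow on pairs of slices
  (\<open>recurrence_iff_flow\<close>). Testing the equation with the difference of the new and the old slice gives
  conservation of the energy (\<open>energy_conserved\<close>): the divided difference is made so that the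
  nonlinear term contributes exactly the increment of \<open>W\<close>. Since \<open>W\<close> is bounded below, the
  energy controls the norm (\<open>norm_le_energy\<close>), which gives the a priori estimate and the
  boundedness of solutions.

  One step is a bounded linear map plus a scalar multiple of the unit sequence at the origin, the scalar
  being a continuous function of finitely many continuous linear functionals. Such a map
  is continuous both in norm and weakly (\<open>weakly_continuous_step\<close>), and so are its iterates.
\<close>

section \<open>Divided differences of polynomials\<close>

text \<open>Each lower-order term is absorbed by a share of the leading one for large \<open>x\<close> and is bounded
  for small \<open>x\<close>; the induction hands half of \<open>c\<close> to each new term.\<close>

lemma sum_powers_le_higher_power:
  fixes D :: "'i \<Rightarrow> real" and e :: "'i \<Rightarrow> nat"
  assumes "finite Q" and "c > 0" and "\<And>q. q \<in> Q \<Longrightarrow> e q < N"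
  shows "\<exists>K\<ge>0. \<forall>x\<ge>0. (\<Sum>q\<in>Q. D q * x ^ e q) \<le> c * x ^ N + K"
  using assms
proof (induction Q arbitrary: c)
  case empty
  then show ?case by (intro exI[of _ 0]) auto
next
  case (insert q Q)
  obtain K where K: "K \<ge> 0" "\<And>x. x \<ge> 0 \<Longrightarrow> (\<Sum>q\<in>Q. D q * x ^ e q) \<le> c / 2 * x ^ N + K"
    using insert.IH[of "c / 2"] insert.prems by auto
  \<comment> \<open>the threshold beyond which \<open>c / 2 * x\<close> dominates \<open>\<bar>D q\<bar>\<close>; it is at least 1, so powers increase there\<close>
  define R where "R = 2 * \<bar>D q\<bar> / c + 1"
  have R: "R \<ge> 1" "\<bar>D q\<bar> \<le> c / 2 * R"
    using insert.prems(1) by (auto simp: R_def field_simps)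
  have "D q * x ^ e q \<le> c / 2 * x ^ N + \<bar>D q\<bar> * R ^ e q" if x: "x \<ge> 0" for x
  proof (cases "x \<le> R")
    case True
    have "D q * x ^ e q \<le> \<bar>D q\<bar> * x ^ e q"
      using x by (intro mult_right_mono) auto
    also have "\<dots> \<le> \<bar>D q\<bar> * R ^ e q"
      using x True by (intro mult_left_mono power_mono) auto
    finally have "D q * x ^ e q \<le> \<bar>D q\<bar> * R ^ e q" .
    moreover have "0 \<le> c / 2 * x ^ N"
      using x insert.prems(1) by simp
    ultimately show ?thesis by linarith
  next
    case False
    have "D q * x ^ e q \<le> \<bar>D q\<bar> * x ^ e q"
      using x by (intro mult_right_mono) auto
    also have "\<dots> \<le> (c / 2 * x) * x ^ e q"
    proof (intro mult_right_mono)
      have "c / 2 * R \<le> c / 2 * x"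
        using False insert.prems(1) by (intro mult_left_mono) auto
      then show "\<bar>D q\<bar> \<le> c / 2 * x" using R by linarith
    qed (use x in simp)
    also have "\<dots> = c / 2 * x ^ Suc (e q)" by simp
    also have "\<dots> \<le> c / 2 * x ^ N"
      using insert.prems False R by (intro mult_left_mono power_increasing) (auto simp: Suc_le_eq)
    finally show ?thesis using R by (smt (verit) mult_nonneg_nonneg zero_le_power)
  qed
  with K R insert show ?case
    by (intro exI[of _ "K + \<bar>D q\<bar> * R ^ e q"]) (auto simp: algebra_simps,
        smt (verit) distrib_right field_sum_of_halves mult.commute)
qed

text \<open>For \<open>W l = (\<Sum>q=0..p. C q * l ^ (q + 1))\<close> this is the divided difference
  \<open>(W s - W t) / (s - t)\<close> (\<open>divdiff_eq\<close>), written as a polynomial, so that the diagonal value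
  \<open>W' s\<close> needs no separate case.\<close>

definition divdiff :: "(nat \<Rightarrow> real) \<Rightarrow> nat \<Rightarrow> real \<Rightarrow> real \<Rightarrow> real" where
  "divdiff C p s t = (\<Sum>q=0..p. C q * (\<Sum>i<Suc q. s ^ i * t ^ (q - i)))"

text \<open>The partial derivative of \<open>divdiff\<close> in its first argument.\<close>

definition divdiff' :: "(nat \<Rightarrow> real) \<Rightarrow> nat \<Rightarrow> real \<Rightarrow> real \<Rightarrow> real" where
  "divdiff' C p s t = (\<Sum>q=0..p. C q * (\<Sum>i<Suc q. real i * s ^ (i - 1) * t ^ (q - i)))"

lemma divdiff_eq:
  "(s - t) * divdiff C p s t = (\<Sum>q=0..p. C q * s ^ (q + 1)) - (\<Sum>q=0..p. C q * t ^ (q + 1))"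
proof -
  have "(s - t) * divdiff C p s t = (\<Sum>q=0..p. C q * ((s - t) * (\<Sum>i<Suc q. s ^ i * t ^ (q - i))))"
    unfolding divdiff_def sum_distrib_left by (simp add: mult_ac)
  also have "\<dots> = (\<Sum>q=0..p. C q * (s ^ Suc q - t ^ Suc q))"
    by (simp only: diff_power_eq_sum)
  finally show ?thesis by (simp add: algebra_simps sum_subtractf)
qed

lemma divdiff_diag: "divdiff C p s s = (\<Sum>q=0..p. C q * (real (q + 1) * s ^ q))"
proof -
  have "(\<Sum>i<Suc q. s ^ i * s ^ (q - i)) = (\<Sum>i<Suc q. s ^ q)" for q
    by (intro sum.cong) (auto simp: power_add[symmetric])
  then show ?thesis by (simp add: divdiff_def)
qed

lemma divdiff_commute: "divdiff C p s t = divdiff C p t s"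
proof (cases "s = t")
  case False
  have "(s - t) * divdiff C p s t = (s - t) * divdiff C p t s"
    using divdiff_eq[of s t C p] divdiff_eq[of t s C p] by (simp add: algebra_simps)
  with False show ?thesis by simp
qed simp

lemma has_real_derivative_divdiff:
  "((\<lambda>s. divdiff C p s t) has_real_derivative divdiff' C p s t) (at s)"
  unfolding divdiff_def divdiff'_def
  by (auto intro!: derivative_eq_intros sum.cong simp: mult_ac)

lemma has_real_derivative_polynomial:
  "((\<lambda>s. \<Sum>q=0..p. C q * s ^ (q + 1)) has_real_derivative divdiff C p s s) (at s)"
proof -
  have "((\<lambda>s. s ^ (q + 1)) has_real_derivative real (q + 1) * s ^ q) (at s)" for q
    using DERIV_pow[of "q + 1" s] by simp
  then show ?thesis
    unfolding divdiff_diag by (intro DERIV_sum DERIV_cmult)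
qed

text \<open>Differentiating \<open>(s - t) * divdiff C p s t = W s - W t\<close> in \<open>s\<close>.\<close>

lemma divdiff_derivative_eq: "divdiff C p s t + (s - t) * divdiff' C p s t = divdiff C p s s"
proof -
  have "((\<lambda>s. (s - t) * divdiff C p s t) has_real_derivative
      divdiff C p s t + (s - t) * divdiff' C p s t) (at s)"
    by (auto intro!: derivative_eq_intros has_real_derivative_divdiff)
  moreover have "((\<lambda>s. (s - t) * divdiff C p s t) has_real_derivative divdiff C p s s) (at s)"
    unfolding divdiff_eq
    using DERIV_diff[OF has_real_derivative_polynomial DERIV_const] by simp
  ultimately show ?thesis by (rule DERIV_unique)
qed

lemma continuous_divdiff [continuous_intros]:
  "continuous_on S f \<Longrightarrow> continuous_on S g \<Longrightarrow> continuous_on S (\<lambda>x. divdiff C p (f x) (g x))"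
  unfolding divdiff_def by (intro continuous_intros)

lemma divdiff_diag_bounded_below:
  assumes "C p > 0"
  shows "\<exists>K\<ge>0. \<forall>s\<ge>0. divdiff C p s s \<ge> - K"
proof -
  obtain K where K: "K \<ge> 0" "\<And>x. x \<ge> 0 \<Longrightarrow>
      (\<Sum>q\<in>{0..<p}. - C q * real (q + 1) * x ^ q) \<le> C p * real (p + 1) * x ^ p + K"
    using sum_powers_le_higher_power[of "{0..<p}" "C p * real (p + 1)" "\<lambda>q. q" p "\<lambda>q. - C q * real (q + 1)"]
      assms by auto
  show ?thesis
  proof (intro exI[of _ K] conjI allI impI)
    fix s :: real assume "s \<ge> 0"
    from K(2)[OF this] show "- K \<le> divdiff C p s s"
      unfolding divdiff_diag atLeastLessThanSuc_atLeastAtMost[symmetric]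
      by (simp add: sum_negf mult.assoc)
  qed fact
qed

lemma polynomial_bounded_below:
  assumes "C p > 0"
  shows "bdd_below ((\<lambda>l. \<Sum>q=0..p. C q * l ^ (q + 1)) ` {0::real..})"
proof -
  obtain K where K: "\<And>x. x \<ge> 0 \<Longrightarrow>
      (\<Sum>q\<in>{0..<p}. - C q * x ^ (q + 1)) \<le> C p * x ^ (p + 1) + K"
    using sum_powers_le_higher_power[of "{0..<p}" "C p" "\<lambda>q. q + 1" "p + 1" "\<lambda>q. - C q"]
      assms by auto
  show ?thesis
  proof (rule bdd_belowI2)
    fix s :: real assume "s \<in> {0..}"
    then show "- K \<le> (\<Sum>q=0..p. C q * s ^ (q + 1))"
      using K[of s] unfolding atLeastLessThanSuc_atLeastAtMost[symmetric] by (simp add: sum_negf)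
  qed
qed

text \<open>With \<open>M = max s t\<close>, the part of degree \<open>q \<ge> 1\<close> contributes to the derivative at most a constant times
  \<open>M ^ (q - 1)\<close>, while the top part of degree \<open>p\<close>, which has a positive coefficient, contributes at
  least \<open>C p * M ^ (p - 1)\<close>: both \<open>s ^ (p - 1)\<close> and \<open>t ^ (p - 1)\<close> occur in it. The factor \<open>M\<close> in
  the conclusion bounds, up to a constant, the factor \<open>r\<^sup>2\<close> that the derivative carries below.\<close>

lemma divdiff'_bounded_below:
  assumes C: "C p > 0" and p: "p \<ge> 1"
  shows "\<exists>K\<ge>0. \<forall>s\<ge>0. \<forall>t\<ge>0. max s t * divdiff' C p s t \<ge> - K"
proof -
  define k where "k q s t = (\<Sum>i<Suc q. real i * s ^ (i - 1) * t ^ (q - i))" for q and s t :: real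
  have k_nonneg: "0 \<le> k q s t" if "s \<ge> 0" "t \<ge> 0" for q s t
    unfolding k_def using that by (intro sum_nonneg) auto
  have k_le: "max s t * k q s t \<le> (real q + 1)\<^sup>2 * max s t ^ q" if st: "s \<ge> 0" "t \<ge> 0" for q s t
  proof -
    have "max s t * (real i * s ^ (i - 1) * t ^ (q - i)) \<le> (real q + 1) * max s t ^ q"
      if i: "i < Suc q" for i
    proof (cases "i = 0")
      case False
      have "max s t * (real i * s ^ (i - 1) * t ^ (q - i))
          \<le> max s t * ((real q + 1) * max s t ^ (i - 1) * max s t ^ (q - i))"
        using st i by (intro mult_left_mono mult_mono power_mono) auto
      also have "\<dots> = (real q + 1) * max s t ^ (1 + (i - 1) + (q - i))"
        by (simp only: power_add power_one_right mult_ac)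
      also have "1 + (i - 1) + (q - i) = q" using i False by simp
      finally show ?thesis .
    qed (use st in auto)
    then have "max s t * k q s t \<le> (\<Sum>i<Suc q. (real q + 1) * max s t ^ q)"
      unfolding k_def sum_distrib_left by (intro sum_mono) auto
    then show ?thesis by (simp add: power2_eq_square algebra_simps)
  qed
  have k_ge: "max s t ^ p \<le> max s t * k p s t" if st: "s \<ge> 0" "t \<ge> 0" for s t
  proof -
    have le: "real i * s ^ (i - 1) * t ^ (p - i) \<le> k p s t" if "i < Suc p" for i
      unfolding k_def using that st
      by (intro member_le_sum[where f = "\<lambda>i. real i * s ^ (i - 1) * t ^ (p - i)"]) auto
    have "max s t ^ (p - 1) \<le> k p s t"
    proof (cases "s \<ge> t")
      case True
      have "s ^ (p - 1) \<le> real p * s ^ (p - 1)"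
        using p st mult_right_mono[of 1 "real p" "s ^ (p - 1)"] by simp
      then show ?thesis using le[of p] True by (simp add: max_def)
    next
      case False
      then show ?thesis using le[of 1] p by (simp add: max_def)
    qed
    then have "max s t * max s t ^ (p - 1) \<le> max s t * k p s t"
      using st by (intro mult_left_mono) auto
    moreover have "max s t * max s t ^ (p - 1) = max s t ^ p"
      using p by (cases p) auto
    ultimately show ?thesis by simp
  qed
  obtain K where K: "K \<ge> 0" "\<And>x. x \<ge> 0 \<Longrightarrow>
      (\<Sum>q\<in>{0..<p}. \<bar>C q\<bar> * (real q + 1)\<^sup>2 * x ^ q) \<le> C p * x ^ p + K"
    using sum_powers_le_higher_power[of "{0..<p}" "C p" "\<lambda>q. q" p "\<lambda>q. \<bar>C q\<bar> * (real q + 1)\<^sup>2"]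
      C by auto
  show ?thesis
  proof (intro exI[of _ K] conjI allI impI)
    fix s t :: real assume st: "s \<ge> 0" "t \<ge> 0"
    have "- (\<Sum>q\<in>{0..<p}. C q * (max s t * k q s t)) \<le> (\<Sum>q\<in>{0..<p}. \<bar>C q\<bar> * (real q + 1)\<^sup>2 * max s t ^ q)"
      unfolding sum_negf[symmetric]
    proof (intro sum_mono)
      fix q
      have "- (C q * (max s t * k q s t)) \<le> \<bar>C q\<bar> * (max s t * k q s t)"
        using k_nonneg[OF st, of q] st by (smt (verit) mult_minus_left mult_nonneg_nonneg mult_right_mono)
      also have "\<dots> \<le> \<bar>C q\<bar> * ((real q + 1)\<^sup>2 * max s t ^ q)"
        by (intro mult_left_mono k_le st) auto
      finally show "- (C q * (max s t * k q s t)) \<le> \<bar>C q\<bar> * (real q + 1)\<^sup>2 * max s t ^ q"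
        by (simp add: mult.assoc)
    qed
    also have "\<dots> \<le> C p * max s t ^ p + K"
      using st by (intro K) auto
    also have "\<dots> \<le> C p * (max s t * k p s t) + K"
      using C by (intro add_mono mult_left_mono k_ge st) auto
    finally have "- K \<le> (\<Sum>q\<in>{0..<Suc p}. C q * (max s t * k q s t))" by simp
    also have "\<dots> = max s t * divdiff' C p s t"
      unfolding divdiff'_def k_def atLeastLessThanSuc_atLeastAtMost sum_distrib_left[of "max s t"]
      by (intro sum.cong refl) (simp only: mult_ac sum_distrib_left)
    finally show "- K \<le> max s t * divdiff' C p s t" .
  qed fact
qed

text \<open>The key estimate. Put \<open>t = (cmod z)\<^sup>2\<close> and let \<open>s = (cmod (r * \<omega> - z))\<^sup>2\<close> vary with \<open>r\<close>. Since
  \<open>r\<close> times the derivative of \<open>s\<close> is \<open>s - t + r\<^sup>2\<close>, the derivative of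
  \<open>r * divdiff C p s t\<close> is \<open>W' s + r\<^sup>2 * divdiff' C p s t\<close>. The first term is bounded below because
  the leading coefficient is positive. So is the second: \<open>r\<^sup>2 \<le> 4 * max s t\<close> by the triangle
  inequality, which reduces it to \<open>divdiff'_bounded_below\<close>. The bound is uniform in \<open>z\<close>.\<close>

lemma radial_divdiff_derivative_bounded_below:
  assumes C: "C p > 0" and p: "p \<ge> 1"
  shows "\<exists>K\<ge>0. \<forall>r \<omega> z. cmod \<omega> = 1 \<longrightarrow>
    (\<exists>d\<ge>- K. ((\<lambda>r. r * divdiff C p ((cmod (of_real r * \<omega> - z))\<^sup>2) ((cmod z)\<^sup>2))
      has_real_derivative d) (at r))"
proof -
  obtain K1 where K1: "K1 \<ge> 0" "\<And>s. s \<ge> 0 \<Longrightarrow> divdiff C p s s \<ge> - K1"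
    using divdiff_diag_bounded_below[of C p] C by auto
  obtain K2 where K2: "K2 \<ge> 0" "\<And>s t. s \<ge> 0 \<Longrightarrow> t \<ge> 0 \<Longrightarrow> max s t * divdiff' C p s t \<ge> - K2"
    using divdiff'_bounded_below[of C p] C p by auto
  show ?thesis
  proof (rule exI[of _ "K1 + 4 * K2"], intro conjI allI impI)
    fix r :: real and \<omega> z :: complex
    assume \<omega>: "cmod \<omega> = 1"
    define c where "c = \<omega> \<bullet> z"
    define t where "t = (cmod z)\<^sup>2"
    define s where "s r = r\<^sup>2 - 2 * r * c + t" for r :: real
    have s: "(cmod (of_real r * \<omega> - z))\<^sup>2 = s r" for r
    proof -
      have "\<omega> \<bullet> \<omega> = 1" using \<omega> by (simp add: norm_eq_1)
      moreover have "z \<bullet> z = cmod z * cmod z" by (simp add: dot_square_norm power2_eq_square)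
      ultimately have "(r *\<^sub>R \<omega> - z) \<bullet> (r *\<^sub>R \<omega> - z) = s r"
        by (simp add: s_def c_def t_def inner_diff_left inner_diff_right
            inner_commute[of z \<omega>] power2_eq_square algebra_simps)
      then show ?thesis
        by (simp add: power2_norm_eq_inner scaleR_conv_of_real)
    qed
    have nonneg: "s r \<ge> 0" "t \<ge> 0" unfolding s[symmetric] t_def by auto
    have r: "r\<^sup>2 \<le> 4 * max (s r) t"
    proof -
      have "(cmod (of_real r * \<omega>))\<^sup>2 \<le> (cmod (of_real r * \<omega> - z) + cmod z)\<^sup>2"
        by (intro power_mono) (use norm_triangle_ineq[of "of_real r * \<omega> - z" z] in auto)
      also have "\<dots> \<le> 2 * s r + 2 * t"
        using sum_squares_bound[of "cmod (of_real r * \<omega> - z)" "cmod z"]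
        unfolding s[symmetric] t_def by (simp add: power2_sum)
      also have "\<dots> \<le> 4 * max (s r) t" by simp
      finally show ?thesis using \<omega> by (simp add: norm_mult)
    qed
    define d where "d = divdiff C p (s r) (s r) + r\<^sup>2 * divdiff' C p (s r) t"
    have ds: "(s has_real_derivative 2 * r - 2 * c) (at r)"
      unfolding s_def by (auto intro!: derivative_eq_intros)
    have "((\<lambda>r. r * divdiff C p (s r) t) has_real_derivative
        divdiff C p (s r) t + divdiff' C p (s r) t * (2 * r - 2 * c) * r) (at r)"
      using DERIV_mult[OF DERIV_ident DERIV_chain2[OF has_real_derivative_divdiff[of C p t "s r"] ds]]
      by (simp add: add.commute)
    moreover have "divdiff C p (s r) t + divdiff' C p (s r) t * (2 * r - 2 * c) * r = d"
      unfolding d_def divdiff_derivative_eq[of C p "s r" t, symmetric]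
      by (simp add: s_def power2_eq_square algebra_simps)
    moreover have "d \<ge> - (K1 + 4 * K2)"
    proof -
      have "r\<^sup>2 * divdiff' C p (s r) t \<ge> - 4 * K2"
      proof (cases "divdiff' C p (s r) t \<ge> 0")
        case True
        then show ?thesis using K2(1) by (smt (verit) mult_nonneg_nonneg zero_le_power2)
      next
        case False
        then have "4 * max (s r) t * divdiff' C p (s r) t \<le> r\<^sup>2 * divdiff' C p (s r) t"
          using r by (intro mult_right_mono_neg) auto
        then show ?thesis using K2(2)[OF nonneg] by linarith
      qed
      then show ?thesis using K1(2)[OF nonneg(1)] by (simp add: d_def)
    qed
    ultimately show "\<exists>d\<ge>- (K1 + 4 * K2). ((\<lambda>r. r * divdiff C p ((cmod (of_real r * \<omega> - z))\<^sup>2) ((cmod z)\<^sup>2))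
      has_real_derivative d) (at r)"
      unfolding s t_def[symmetric] by metis
  qed (use K1 K2 in auto)
qed

section \<open>The implicit equation at the origin\<close>

text \<open>The map \<open>w \<mapsto> \<kappa> w z * w\<close> moves every point along its own ray and is strictly increasing on each
  ray, with slope at least one half; hence it is a bijection of the plane, the intermediate value
  theorem giving surjectivity. The inverse is at most \<open>2 * cmod g\<close> and its graph is closed, so it is
  continuous, jointly in the parameter \<open>z\<close>.
  The map need not be monotone on the plane as a whole; only the radial direction is controlled.\<close>

lemma radial_map_continuous_inverse:
  fixes \<kappa> :: "complex \<Rightarrow> complex \<Rightarrow> real"
  assumes cont: "continuous_on UNIV (\<lambda>(w, z). \<kappa> w z)"
    and deriv: "\<And>r \<omega> z. cmod \<omega> = 1 \<Longrightarrow>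
      \<exists>d\<ge>1/2. ((\<lambda>r. r * \<kappa> (of_real r * \<omega>) z) has_real_derivative d) (at r)"
  shows "\<exists>S. continuous_on UNIV (\<lambda>(z, g). S z g) \<and>
    (\<forall>w z g. of_real (\<kappa> w z) * w = g \<longleftrightarrow> w = S z g)"
proof -
  define F where "F \<omega> z r = r * \<kappa> (of_real r * \<omega>) z" for \<omega> z and r :: real
  have F0: "F \<omega> z 0 = 0" for \<omega> z by (simp add: F_def)
  have grow: "(r2 - r1) / 2 \<le> F \<omega> z r2 - F \<omega> z r1" if \<omega>: "cmod \<omega> = 1" and le: "r1 \<le> r2" for \<omega> z r1 r2
  proof -
    have "F \<omega> z r1 - r1 / 2 \<le> F \<omega> z r2 - r2 / 2"
    proof (rule DERIV_nonneg_imp_nondecreasing[OF le])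
      fix r
      obtain d where d: "d \<ge> 1/2" "(F \<omega> z has_real_derivative d) (at r)"
        using deriv[OF \<omega>, where r = r and z = z] unfolding F_def by blast
      have "((\<lambda>r. F \<omega> z r - r / 2) has_real_derivative d - 1 / 2) (at r)"
        by (auto intro!: derivative_eq_intros d(2))
      with d(1) show "\<exists>y. ((\<lambda>r. F \<omega> z r - r / 2) has_real_derivative y) (at r) \<and> 0 \<le> y"
        by (intro exI[of _ "d - 1/2"]) auto
    qed
    then show ?thesis by (simp add: field_simps)
  qed
  have F_inj: "r1 = r2" if "cmod \<omega> = 1" "F \<omega> z r1 = F \<omega> z r2" for \<omega> z r1 r2
  proof -
    have "s = t" if "s \<le> t" "F \<omega> z s = F \<omega> z t" for s t
      using grow[OF \<open>cmod \<omega> = 1\<close> that(1), of z] that(1) unfolding that(2) diff_self by simp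
    then show ?thesis using that(2) linear[of r1 r2] by metis
  qed
  have polar: "cmod (w / cmod w) = 1" "of_real (\<kappa> w z) * w = of_real (F (w / cmod w) z (cmod w)) * (w / cmod w)"
    if "w \<noteq> 0" for w z
    using that by (auto simp: F_def norm_divide)
  have coercive: "cmod w / 2 \<le> cmod (of_real (\<kappa> w z) * w)" and \<kappa>_pos: "w \<noteq> 0 \<Longrightarrow> \<kappa> w z > 0" for w z
  proof -
    have "\<kappa> w z \<ge> 1/2" if "w \<noteq> 0"
    proof -
      have "cmod w * (1 / 2) \<le> cmod w * \<kappa> w z"
        using grow[OF polar(1)[OF that], of 0 "cmod w" z] that by (simp add: F_def)
      then show ?thesis using that by (simp add: mult_le_cancel_left)
    qed
    then show "cmod w / 2 \<le> cmod (of_real (\<kappa> w z) * w)" "w \<noteq> 0 \<Longrightarrow> \<kappa> w z > 0"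
      by (cases "w = 0"; force simp: norm_mult intro: mult_right_mono[of "1/2", simplified])+
  qed
  have ex: "\<exists>w. of_real (\<kappa> w z) * w = g" for z g
  proof (cases "g = 0")
    case False
    define \<omega> where "\<omega> = g / cmod g"
    have \<omega>: "cmod \<omega> = 1" using False by (simp add: \<omega>_def norm_divide)
    have "\<exists>r\<ge>0. r \<le> 2 * cmod g \<and> F \<omega> z r = cmod g"
    proof (rule IVT')
      show "cmod g \<le> F \<omega> z (2 * cmod g)"
        using grow[OF \<omega>, of 0 "2 * cmod g" z] by (simp add: F0)
      show "continuous_on {0..2 * cmod g} (F \<omega> z)"
        using deriv[OF \<omega>, where z = z] unfolding F_def[symmetric]
        by (intro continuous_at_imp_continuous_on ballI) (blast intro: DERIV_isCont)
    qed (auto simp: F0)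
    then obtain r where "F \<omega> z r = cmod g" by auto
    then have "of_real (\<kappa> (of_real r * \<omega>) z) * (of_real r * \<omega>) = of_real (cmod g) * \<omega>"
      by (simp add: F_def mult_ac flip: of_real_mult)
    also have "\<dots> = g" using False by (simp add: \<omega>_def)
    finally show ?thesis by blast
  qed auto
  have uniq: "w1 = w2" if eq: "of_real (\<kappa> w1 z) * w1 = of_real (\<kappa> w2 z) * w2" for w1 w2 z
  proof (cases "w1 = 0 \<or> w2 = 0")
    case True
    then show ?thesis using eq \<kappa>_pos
      by (metis less_irrefl mult_eq_0_iff of_real_eq_0_iff)
  next
    case False
    define g where "g = of_real (\<kappa> w1 z) * w1"
    have dir: "w / cmod w = g / cmod g" and mod: "F (g / cmod g) z (cmod w) = cmod g"
      if "w \<noteq> 0" "g = of_real (\<kappa> w z) * w" for w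
    proof -
      show dir: "w / cmod w = g / cmod g"
        using that \<kappa>_pos[of w z] by (simp add: norm_mult)
      show "F (g / cmod g) z (cmod w) = cmod g"
        unfolding dir[symmetric] using that \<kappa>_pos[of w z] by (simp add: F_def norm_mult)
    qed
    have g: "g = of_real (\<kappa> w2 z) * w2" using eq by (simp add: g_def)
    have g1: "cmod (g / cmod g) = 1" using polar(1)[of w1] dir[of w1] g_def False by simp
    have "F (g / cmod g) z (cmod w1) = F (g / cmod g) z (cmod w2)"
      using mod[of w1] mod[of w2] False g_def g by simp
    then have "cmod w1 = cmod w2" by (rule F_inj[OF g1])
    moreover have "w1 / cmod w1 = w2 / cmod w2" using dir[of w1] dir[of w2] False g_def g by simp
    ultimately show ?thesis using False by simp
  qed
  define S where "S z g = (THE w. of_real (\<kappa> w z) * w = g)" for z g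
  have S: "of_real (\<kappa> w z) * w = g \<longleftrightarrow> w = S z g" for w z g
  proof -
    have "\<exists>!w. of_real (\<kappa> w z) * w = g" using ex uniq by metis
    from theI'[OF this] show ?thesis using uniq unfolding S_def[symmetric] by metis
  qed
  have bound: "cmod (S z g) \<le> 2 * cmod g" for z g
    using coercive[of "S z g" z] S[of "S z g" z g] by simp
  have "continuous_on (cball 0 R) (\<lambda>(z, g). S z g)" for R
  proof (rule continuous_from_closed_graph)
    have "cmod (S z g) \<le> 2 * R" if "(z, g) \<in> cball 0 R" for z g
    proof -
      have "norm (z, g) \<le> R" using that by (simp only: mem_cball_0)
      with bound[of z g] norm_snd_le[of g z] show ?thesis by linarith
    qed
    then show "(\<lambda>(z, g). S z g) \<in> cball 0 R \<rightarrow> cball 0 (2 * R)" by auto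
    have "(\<lambda>x. (x, case x of (z, g) \<Rightarrow> S z g)) ` cball 0 R =
        {x. fst x \<in> cball 0 R} \<inter>
        {x. of_real (case (snd x, fst (fst x)) of (w, z) \<Rightarrow> \<kappa> w z) * snd x = snd (fst x)}"
      using S by (auto simp: image_iff)
    also have "closed \<dots>"
    proof (intro closed_Int closed_Collect_eq)
      have "closed (fst -` cball 0 R :: ((complex \<times> complex) \<times> complex) set)"
        by (intro closed_vimage closed_cball continuous_intros)
      then show "closed {x :: (complex \<times> complex) \<times> complex. fst x \<in> cball 0 R}"
        by (simp add: vimage_def)
      show "continuous_on UNIV (\<lambda>x. of_real (case (snd x, fst (fst x)) of (w, z) \<Rightarrow> \<kappa> w z) * snd x
          :: complex)"
        by (intro continuous_intros continuous_on_compose2[OF cont]) auto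
    qed (intro continuous_intros)
    finally show "closed ((\<lambda>x. (x, case x of (z, g) \<Rightarrow> S z g)) ` cball 0 R)" .
  qed simp
  then have "continuous_on (ball 0 R) (\<lambda>(z, g). S z g)" for R
    by (rule continuous_on_subset[OF _ ball_subset_cball])
  then have "continuous_on (\<Union>R. ball 0 R) (\<lambda>(z, g). S z g)"
    by (intro continuous_on_open_UN) auto
  moreover have "(\<Union>R. ball 0 R) = (UNIV :: (complex \<times> complex) set)"
    by (auto intro: gt_ex)
  ultimately have "continuous_on UNIV (\<lambda>(z, g). S z g)" by simp
  with S show ?thesis by blast
qed

section \<open>Square-summable families\<close>

lemma ell2_eqI: "(\<And>x. coord u x = coord v x) \<Longrightarrow> u = v"
  by (simp add: coord_inject[symmetric] fun_eq_iff)

lemma square_summable_coord: "(\<lambda>x. (cmod (coord u x))\<^sup>2) summable_on UNIV"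
  using coord[of u] by simp

lemma has_sum_norm_ell2: "((\<lambda>x. (cmod (coord u x))\<^sup>2) has_sum (norm u)\<^sup>2) UNIV"
proof -
  have "(norm u)\<^sup>2 = (\<Sum>\<^sub>\<infinity>x. (cmod (coord u x))\<^sup>2)"
    by (simp add: norm_ell2.rep_eq infsum_nonneg)
  then show ?thesis using square_summable_coord[of u] by simp
qed

lemma coord_sum: "coord (\<Sum>i\<in>I. f i) x = (\<Sum>i\<in>I. coord (f i) x)"
  by (induction I rule: infinite_finite_induct) (simp_all add: zero_ell2.rep_eq plus_ell2.rep_eq)

lemmas coord_simps = zero_ell2.rep_eq plus_ell2.rep_eq minus_ell2.rep_eq uminus_ell2.rep_eq
  scaleR_ell2.rep_eq cscale.rep_eq coord_sum

lemma cmod_coord_le: "cmod (coord u x) \<le> norm u"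
proof -
  have "(cmod (coord u x))\<^sup>2 \<le> (norm u)\<^sup>2"
    using finite_sum_le_has_sum[OF has_sum_norm_ell2[of u], of "{x}"] by simp
  then show ?thesis by (rule power2_le_imp_le) simp
qed

lemma bounded_linear_coord: "bounded_linear (\<lambda>u. coord u x)"
  by (rule bounded_linear_intro[of _ 1])
    (simp_all add: coord_simps scaleR_conv_of_real cmod_coord_le)

text \<open>Polarization reduces this to the square summability of the sum.\<close>

lemma inner_coord_summable: "(\<lambda>x. coord u x \<bullet> coord v x) summable_on UNIV"
proof -
  have "(\<lambda>x. ((cmod (coord (u + v) x))\<^sup>2 + - (cmod (coord u x))\<^sup>2 + - (cmod (coord v x))\<^sup>2) / 2) summable_on UNIV"
    unfolding divide_inverse
    by (intro summable_on_cmult_left summable_on_add square_summable_coord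
        summable_on_uminus[THEN iffD2])
  moreover have "((cmod (coord (u + v) x))\<^sup>2 - (cmod (coord u x))\<^sup>2 - (cmod (coord v x))\<^sup>2) / 2
      = coord u x \<bullet> coord v x" for x
    by (simp add: coord_simps dot_norm)
  ultimately show ?thesis by simp
qed

text \<open>The energy is a quadratic form, and its conservation is a statement about real inner products;
  so the real part of the complex inner product is enough.\<close>

instantiation ell2 :: (type) real_inner
begin
definition inner_ell2 :: "'a ell2 \<Rightarrow> 'a ell2 \<Rightarrow> real" where
  "inner_ell2 u v = (\<Sum>\<^sub>\<infinity>x. coord u x \<bullet> coord v x)"
instance
proof
  fix u v w :: "'a ell2" and r :: real
  have sq: "u \<bullet> u = (norm u)\<^sup>2" for u :: "'a ell2"
    using has_sum_norm_ell2[of u] by (auto simp: inner_ell2_def power2_norm_eq_inner intro: infsumI)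
  show "u \<bullet> v = v \<bullet> u" by (simp add: inner_ell2_def inner_commute)
  show "(u + v) \<bullet> w = u \<bullet> w + v \<bullet> w"
    by (simp add: inner_ell2_def coord_simps inner_add_left infsum_add inner_coord_summable)
  show "(r *\<^sub>R u) \<bullet> v = r * (u \<bullet> v)"
    by (simp add: inner_ell2_def coord_simps infsum_cmult_right' flip: scaleR_conv_of_real)
  show "0 \<le> u \<bullet> u" "(u \<bullet> u = 0) = (u = 0)" "norm u = sqrt (u \<bullet> u)"
    by (simp_all add: sq)
qed
end

lemma inner_ell2_delta:
  assumes "\<And>x. x \<noteq> a \<Longrightarrow> coord u x = 0"
  shows "v \<bullet> u = coord v a \<bullet> coord u a"
proof -
  have "((\<lambda>x. coord v x \<bullet> coord u x) has_sum (coord v a \<bullet> coord u a)) {a}"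
    by (simp add: has_sum_finite_iff)
  then have "((\<lambda>x. coord v x \<bullet> coord u x) has_sum (coord v a \<bullet> coord u a)) UNIV"
    by (rule has_sum_cong_neutral[THEN iffD1, rotated -1]) (use assms in auto)
  then show ?thesis unfolding inner_ell2_def by (rule infsumI)
qed

lift_definition delta :: "'a \<Rightarrow> complex \<Rightarrow> 'a ell2" is "\<lambda>a c x. if x = a then c else 0"
proof -
  fix a :: 'a and c :: complex
  have "(\<lambda>x. (cmod (if x = a then c else 0))\<^sup>2) summable_on {a}" by simp
  then show "(\<lambda>x. (cmod (if x = a then c else 0))\<^sup>2) summable_on UNIV"
    by (rule summable_on_cong_neutral[THEN iffD1, rotated -1]) auto
qed

lemma bounded_linear_delta: "bounded_linear (delta a)"
proof (rule bounded_linear_intro[of _ 1])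
  fix c
  have "(norm (delta a c))\<^sup>2 = (cmod c)\<^sup>2"
    using inner_ell2_delta[of a "delta a c" "delta a c"]
    by (simp add: power2_norm_eq_inner delta.rep_eq)
  then show "norm (delta a c) \<le> cmod c * 1" by simp
qed (auto intro!: ell2_eqI simp: coord_simps delta.rep_eq scaleR_conv_of_real)

lift_definition translate :: "'a::ab_group_add \<Rightarrow> 'a ell2 \<Rightarrow> 'a ell2" is "\<lambda>e u x. u (x + e)"
  subgoal for e u
    using summable_on_reindex_bij_betw[OF bij_plus_right[of e], of "\<lambda>x. (cmod (u x))\<^sup>2"] by simp
  done

lemma inner_translate: "translate e u \<bullet> v = u \<bullet> translate (- e) v"
proof -
  have "translate e u \<bullet> v = (\<Sum>\<^sub>\<infinity>x. coord u (x + e) \<bullet> coord v (x + e - e))"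
    by (simp add: inner_ell2_def translate.rep_eq)
  also have "\<dots> = (\<Sum>\<^sub>\<infinity>x. coord u x \<bullet> coord v (x - e))"
    by (rule infsum_reindex_bij_betw[OF bij_plus_right[of e], of "\<lambda>x. coord u x \<bullet> coord v (x - e)"])
  finally show ?thesis by (simp add: inner_ell2_def translate.rep_eq)
qed

lemma norm_translate [simp]: "norm (translate e u) = norm u"
proof -
  have "translate (- e) (translate e u) = u"
    by (rule ell2_eqI) (simp add: translate.rep_eq)
  then show ?thesis by (simp add: norm_eq_sqrt_inner inner_translate)
qed

lemma bounded_linear_translate: "bounded_linear (translate e)"
  by (rule bounded_linear_intro[of _ 1]) (auto intro!: ell2_eqI simp: coord_simps translate.rep_eq)

definition average :: "(int ^ 'n::finite) ell2 \<Rightarrow> (int ^ 'n) ell2" where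
  "average u = (1 / real CARD('n)) *\<^sub>R (\<Sum>j\<in>UNIV. translate (axis j 1) u + translate (- axis j 1) u)"

lemma coord_average:
  fixes u :: "(int ^ 'n::finite) ell2"
  shows "coord (average u) X =
    1 / of_nat CARD('n) * (\<Sum>j\<in>UNIV. coord u (X + axis j 1) + coord u (X - axis j 1))"
  by (simp add: average_def coord_simps translate.rep_eq)

lemma bounded_linear_average: "bounded_linear average"
  unfolding average_def
  by (intro bounded_linear_const_scaleR bounded_linear_sum bounded_linear_add
      bounded_linear_translate)

lemma average_cscale: "average (cscale c u) = cscale c (average u)"
  by (rule ell2_eqI) (simp add: coord_average coord_simps sum_distrib_left algebra_simps)

lemma inner_average: "average u \<bullet> v = u \<bullet> average v"
  by (simp add: average_def inner_sum_left inner_sum_right inner_add_left inner_add_right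
      inner_translate add.commute)

section \<open>The scheme as a reversible recurrence\<close>

text \<open>The pair consists of the values at two consecutive times. The backward step uses the same \<open>N\<close>,
  which is right when \<open>N v\<close> is an involution, that is, when the recurrence is symmetric under
  reversal of time.\<close>

definition flow :: "('a \<Rightarrow> 'a \<Rightarrow> 'a) \<Rightarrow> int \<Rightarrow> 'a \<times> 'a \<Rightarrow> 'a \<times> 'a" where
  "flow N T = (if 0 \<le> T then (\<lambda>(w, v). (v, N v w)) ^^ nat T else (\<lambda>(w, v). (N w v, w)) ^^ nat (- T))"

lemma flow_induct:
  assumes "P id" and "\<And>f. P f \<Longrightarrow> P ((\<lambda>(w, v). (v, N v w)) \<circ> f)"
    and "\<And>f. P f \<Longrightarrow> P ((\<lambda>(w, v). (N w v, w)) \<circ> f)"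
  shows "P (flow N T)"
proof -
  have "P ((\<lambda>(w, v). (v, N v w)) ^^ k)" "P ((\<lambda>(w, v). (N w v, w)) ^^ k)" for k
    by (induction k) (auto simp: assms(1) intro: assms(2,3))
  then show ?thesis by (simp add: flow_def)
qed

lemma flow_0 [simp]: "flow N 0 u = u"
  by (simp add: flow_def)

lemma flow_add_one:
  assumes rev: "\<And>v w. N v (N v w) = w"
  shows "flow N (T + 1) u = (\<lambda>(w, v). (v, N v w)) (flow N T u)"
proof (cases "T \<ge> 0")
  case True
  then have "nat (T + 1) = Suc (nat T)" by simp
  with True show ?thesis by (simp add: flow_def)
next
  case False
  define k where "k = nat (- T - 1)"
  have "nat (- T) = Suc k" using False by (simp add: k_def)
  then have "flow N T u = (\<lambda>(w, v). (N w v, w)) (((\<lambda>(w, v). (N w v, w)) ^^ k) u)"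
    using False by (simp add: flow_def)
  moreover have "flow N (T + 1) u = ((\<lambda>(w, v). (N w v, w)) ^^ k) u"
  proof (cases "T = - 1")
    case True
    then show ?thesis by (simp add: flow_def k_def)
  next
    case False
    with \<open>\<not> T \<ge> 0\<close> have "\<not> 0 \<le> T + 1" "nat (- (T + 1)) = k" by (auto simp: k_def)
    then show ?thesis by (simp add: flow_def)
  qed
  ultimately show ?thesis by (simp add: rev split: prod.splits)
qed

lemma recurrence_iff_flow:
  assumes rev: "\<And>v w. N v (N v w) = w"
  shows "(\<psi> 0, \<psi> 1) = u \<and> (\<forall>T. \<psi> (T + 1) = N (\<psi> T) (\<psi> (T - 1)))
    \<longleftrightarrow> \<psi> = (\<lambda>T. fst (flow N T u))" (is "?L \<longleftrightarrow> ?R")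
proof -
  have eq: "(\<psi> T, \<psi> (T + 1)) = flow N T u" if ini: "(\<psi> 0, \<psi> 1) = u"
    and rec: "\<And>T. \<psi> (T + 1) = N (\<psi> T) (\<psi> (T - 1))" for T
  proof (induction T rule: int_induct[where k = 0])
    case base
    then show ?case using ini by simp
  next
    case (step1 i)
    then show ?case using rec[of "i + 1"] by (simp add: flow_add_one[of N, OF rev] step1(2)[symmetric])
  next
    case (step2 i)
    obtain w v where wv: "flow N (i - 1) u = (w, v)" by fastforce
    then have "v = \<psi> i" "\<psi> (i + 1) = N v w"
      using step2(2) flow_add_one[of N, OF rev, where T = "i - 1" and u = u] by auto
    moreover have "\<psi> (i - 1) = w"
      using rec[of i] rev calculation by metis
    ultimately show ?case using wv by simp
  qed
  have snd: "snd (flow N T u) = fst (flow N (T + 1) u)" for T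
    by (simp add: flow_add_one[of N, OF rev] split: prod.splits)
  have "fst (flow N (T + 1) u) = N (fst (flow N T u)) (fst (flow N (T - 1) u))" for T
    using flow_add_one[of N, OF rev, where T = "T - 1" and u = u] snd[of T] flow_add_one[of N, OF rev, where T = T and u = u]
    by (auto split: prod.splits)
  moreover have "fst (flow N 1 u) = snd u" using snd[of 0] by simp
  ultimately show "?L \<longleftrightarrow> ?R" using eq by (auto simp: fun_eq_iff) (metis fst_conv)
qed

text \<open>The equation at the origin, for the unknown \<open>w\<close>, the sum of the new and the old value there. Here
  \<open>z\<close> is the old value, \<open>w - z\<close> the new one, and \<open>g\<close> the average of the current slice over the
  neighbours of the origin. The locale fixes a continuous solution operator \<open>S\<close>, which exists for
  small \<open>\<tau>\<close>.\<close>

locale discrete_KG =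
  fixes C :: "nat \<Rightarrow> real" and p :: nat and m \<tau> :: real
    and S :: "complex \<Rightarrow> complex \<Rightarrow> complex"
  assumes C: "C p > 0" and m: "m > 0" and \<tau>: "\<tau> > 0"
    and S: "\<And>w z g. of_real (1 + \<tau>\<^sup>2 * m\<^sup>2 / 2
        + \<tau>\<^sup>2 / 2 * divdiff C p ((cmod (w - z))\<^sup>2) ((cmod z)\<^sup>2)) * w = g \<longleftrightarrow> w = S z g"
    and S_cont: "continuous_on UNIV (\<lambda>(z, g). S z g)"
begin

definition W :: "real \<Rightarrow> real" where "W l = (\<Sum>q=0..p. C q * l ^ (q + 1))"

definition a :: real where "a = 1 + \<tau>\<^sup>2 * m\<^sup>2 / 2"

lemma a_pos: "a > 0"
  by (simp add: a_def add_pos_nonneg)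

text \<open>The new slice, given the current slice \<open>v\<close> and the old slice \<open>w\<close>: the solution of the linear
  equation, plus a correction at the origin that replaces the linear value there of new plus old
  by \<open>S\<close>.\<close>

definition next_slice :: "(int ^ 'n::finite) ell2 \<Rightarrow> (int ^ 'n) ell2 \<Rightarrow> (int ^ 'n) ell2" where
  "next_slice v w = (1 / a) *\<^sub>R average v - w
    + delta 0 (S (coord w 0) (coord (average v) 0) - coord (average v) 0 / of_real a)"

text \<open>The equation for three consecutive slices \<open>u\<close>, \<open>v\<close>, \<open>w\<close>, as an identity in the sequence space. For
  the chosen ratio of the steps the diagonal terms of the two second differences cancel, so the
  middle slice enters only through its average over neighbours.\<close>

definition balanced :: "(int ^ 'n::finite) ell2 \<Rightarrow> (int ^ 'n) ell2 \<Rightarrow> (int ^ 'n) ell2 \<Rightarrow> bool" where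
  "balanced u v w \<longleftrightarrow> a *\<^sub>R (u + w) = average v
    - (\<tau>\<^sup>2 / 2 * divdiff C p ((cmod (coord u 0))\<^sup>2) ((cmod (coord w 0))\<^sup>2)) *\<^sub>R delta 0 (coord (u + w) 0)"

lemma balanced_commute: "balanced u v w \<longleftrightarrow> balanced w v u"
  by (simp add: balanced_def add.commute[of u] divdiff_commute)

lemma balanced_iff_next_slice: "balanced u v w \<longleftrightarrow> u = next_slice v w"
proof -
  let ?b = "divdiff C p ((cmod (coord u 0))\<^sup>2) ((cmod (coord w 0))\<^sup>2)"
  have 0: "of_real a * (coord u 0 + coord w 0) = coord (average v) 0 - of_real (\<tau>\<^sup>2 / 2 * ?b) * (coord u 0 + coord w 0)
      \<longleftrightarrow> coord u 0 + coord w 0 = S (coord w 0) (coord (average v) 0)"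
    using S[of "coord u 0 + coord w 0" "coord w 0" "coord (average v) 0"]
    by (simp add: a_def algebra_simps)
  have "balanced u v w \<longleftrightarrow> (\<forall>X. of_real a * (coord u X + coord w X) = coord (average v) X
      - of_real (\<tau>\<^sup>2 / 2 * ?b) * (if X = 0 then coord u 0 + coord w 0 else 0))"
    unfolding balanced_def coord_inject[symmetric] fun_eq_iff coord_simps delta.rep_eq ..
  also have "\<dots> \<longleftrightarrow> (\<forall>X. coord u X = of_real (1 / a) * coord (average v) X - coord w X
      + (if X = 0 then S (coord w 0) (coord (average v) 0) - coord (average v) 0 / of_real a else 0))"
  proof (intro all_cong1)
    fix X
    show "of_real a * (coord u X + coord w X) = coord (average v) X
        - of_real (\<tau>\<^sup>2 / 2 * ?b) * (if X = 0 then coord u 0 + coord w 0 else 0)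
      \<longleftrightarrow> coord u X = of_real (1 / a) * coord (average v) X - coord w X
        + (if X = 0 then S (coord w 0) (coord (average v) 0) - coord (average v) 0 / of_real a else 0)"
    proof (cases "X = 0")
      case True
      then show ?thesis using 0 by (auto simp: algebra_simps)
    next
      case False
      then show ?thesis using a_pos by (auto simp: field_simps)
    qed
  qed
  also have "\<dots> \<longleftrightarrow> u = next_slice v w"
    unfolding next_slice_def coord_inject[symmetric] fun_eq_iff coord_simps delta.rep_eq ..
  finally show ?thesis .
qed

text \<open>Symmetry of the divided difference makes the scheme reversible in time.\<close>

lemma next_slice_involutive: "next_slice v (next_slice v w) = w"
  using balanced_iff_next_slice balanced_commute by metis

lemma bterm_eq_divdiff:
  "bterm W \<psi> T = divdiff C p ((cmod (\<psi> (T + 1) 0))\<^sup>2) ((cmod (\<psi> (T - 1) 0))\<^sup>2)"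
proof (cases "cmod (\<psi> (T + 1) 0) = cmod (\<psi> (T - 1) 0)")
  case True
  have "deriv W s = divdiff C p s s" for s
    unfolding W_def by (intro DERIV_imp_deriv has_real_derivative_polynomial)
  with True show ?thesis by (simp add: bterm_def)
next
  case False
  define s where "s = (cmod (\<psi> (T + 1) 0))\<^sup>2"
  define t where "t = (cmod (\<psi> (T - 1) 0))\<^sup>2"
  have "s - t \<noteq> 0"
    using False power2_eq_iff_nonneg[of "cmod (\<psi> (T + 1) 0)" "cmod (\<psi> (T - 1) 0)"]
    by (simp add: s_def t_def)
  moreover have "bterm W \<psi> T = (W s - W t) / (s - t)"
    using False by (simp only: bterm_def s_def t_def if_True simp_thms)
  moreover have "W s - W t = (s - t) * divdiff C p s t"
    by (simp only: W_def divdiff_eq)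
  ultimately have "bterm W \<psi> T = divdiff C p s t" by simp
  then show ?thesis by (simp only: s_def t_def)
qed

lemma KG_iff:
  fixes \<psi> :: "int \<Rightarrow> (int ^ 'n::finite) ell2"
  shows "KG W m \<tau> (\<lambda>T. coord (\<psi> T)) \<longleftrightarrow> (\<forall>T. balanced (\<psi> (T + 1)) (\<psi> T) (\<psi> (T - 1)))"
proof -
  have DX: "1 / of_nat CARD('n) * DX2 (\<lambda>T. coord (\<psi> T)) T X = coord (average (\<psi> T)) X - 2 * coord (\<psi> T) X"
    for T X
  proof -
    have "DX2 (\<lambda>T. coord (\<psi> T)) T X =
        (\<Sum>j\<in>UNIV. coord (\<psi> T) (X + axis j 1) + coord (\<psi> T) (X - axis j 1))
          - of_nat CARD('n) * (2 * coord (\<psi> T) X)"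
      by (simp add: DX2_def sum.distrib sum_subtractf)
    then show ?thesis by (simp add: coord_average right_diff_distrib)
  qed
  have alg: "(u - 2 * v + w) - (A - 2 * v) + of_real (\<tau>\<^sup>2 * m\<^sup>2) * ((u + w) / 2)
        = - of_real (\<tau>\<^sup>2) * d * of_real b * ((u0 + w0) / 2)
      \<longleftrightarrow> of_real a * (u + w) = A - of_real (\<tau>\<^sup>2 / 2 * b) * (d * (u0 + w0))"
    for u v w A u0 w0 d :: complex and b
  proof -
    have "(u - 2 * v + w) - (A - 2 * v) + of_real (\<tau>\<^sup>2 * m\<^sup>2) * ((u + w) / 2)
        - (- of_real (\<tau>\<^sup>2) * d * of_real b * ((u0 + w0) / 2))
      = of_real a * (u + w) - (A - of_real (\<tau>\<^sup>2 / 2 * b) * (d * (u0 + w0)))"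
      by (simp add: a_def algebra_simps)
    then show ?thesis by (metis right_minus_eq)
  qed
  have delta: "coord (delta 0 c) X = (if X = 0 then 1 else 0) * c" for c and X :: "int ^ 'n"
    by (simp add: delta.rep_eq)
  show ?thesis
    unfolding KG_def DX DT2_def alg balanced_def coord_inject[symmetric] fun_eq_iff coord_simps delta
      bterm_eq_divdiff
    by (rule all_comm)
qed

end

section \<open>Energy conservation\<close>

context discrete_KG
begin

lemma energy_eq_norms:
  fixes \<psi> :: "int \<Rightarrow> (int ^ 'n::finite) ell2"
  shows "energy W m \<tau> \<epsilon> (\<lambda>T. coord (\<psi> T)) T = \<epsilon> ^ CARD('n) *
    ((\<Sum>j\<in>UNIV. ((norm (\<psi> (T + 1) - translate (- axis j 1) (\<psi> T)))\<^sup>2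
        + (norm (\<psi> (T + 1) - translate (axis j 1) (\<psi> T)))\<^sup>2) / (4 * real CARD('n) * \<tau>\<^sup>2))
      + m\<^sup>2 * (((norm (\<psi> (T + 1)))\<^sup>2 + (norm (\<psi> T))\<^sup>2) / 4))
    + \<epsilon> ^ CARD('n) * ((W ((cmod (coord (\<psi> (T + 1)) 0))\<^sup>2) + W ((cmod (coord (\<psi> T) 0))\<^sup>2)) / 4)"
proof -
  have tr: "((\<lambda>X. (cmod (coord u X - coord v (X + e)))\<^sup>2) has_sum (norm (u - translate e v))\<^sup>2) UNIV"
    for u v :: "(int ^ 'n) ell2" and e
    using has_sum_norm_ell2[of "u - translate e v"] by (simp add: coord_simps translate.rep_eq)
  have has_sum_sum: "((\<lambda>X. \<Sum>j\<in>J. f j X) has_sum (\<Sum>j\<in>J. s j)) A"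
    if "\<And>j. j \<in> J \<Longrightarrow> (f j has_sum s j) A"
    for f :: "'n \<Rightarrow> int ^ 'n \<Rightarrow> real" and s and J :: "'n set" and A
    using finite[of J] that by (induction J rule: finite_induct) (auto intro: has_sum_add)
  have "((\<lambda>X. \<epsilon> ^ CARD('n) *
    ((\<Sum>j\<in>UNIV. ((cmod (coord (\<psi> (T + 1)) X - coord (\<psi> T) (X + - axis j 1)))\<^sup>2
        + (cmod (coord (\<psi> (T + 1)) X - coord (\<psi> T) (X + axis j 1)))\<^sup>2) * (1 / (4 * real CARD('n) * \<tau>\<^sup>2)))
      + m\<^sup>2 * (((cmod (coord (\<psi> (T + 1)) X))\<^sup>2 + (cmod (coord (\<psi> T) X))\<^sup>2) * (1 / 4)))) has_sum
    \<epsilon> ^ CARD('n) *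
    ((\<Sum>j\<in>UNIV. ((norm (\<psi> (T + 1) - translate (- axis j 1) (\<psi> T)))\<^sup>2
        + (norm (\<psi> (T + 1) - translate (axis j 1) (\<psi> T)))\<^sup>2) * (1 / (4 * real CARD('n) * \<tau>\<^sup>2)))
      + m\<^sup>2 * (((norm (\<psi> (T + 1)))\<^sup>2 + (norm (\<psi> T))\<^sup>2) * (1 / 4)))) UNIV"
    by (intro has_sum_cmult_right has_sum_cmult_left has_sum_add has_sum_sum tr has_sum_norm_ell2)
  from infsumI[OF this] show ?thesis by (simp add: energy_def)
qed

text \<open>Expanding the squares and using that translations are isometries turns the energy into a
  quadratic form in two slices whose only mixed term is \<open>u \<bullet> average v\<close>.\<close>

lemma energy_eq_inner:
  fixes \<psi> :: "int \<Rightarrow> (int ^ 'n::finite) ell2"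
  shows "energy W m \<tau> \<epsilon> (\<lambda>T. coord (\<psi> T)) T = \<epsilon> ^ CARD('n) / (2 * \<tau>\<^sup>2) *
    (a * ((norm (\<psi> (T + 1)))\<^sup>2 + (norm (\<psi> T))\<^sup>2) - \<psi> (T + 1) \<bullet> average (\<psi> T)
      + \<tau>\<^sup>2 / 2 * (W ((cmod (coord (\<psi> (T + 1)) 0))\<^sup>2) + W ((cmod (coord (\<psi> T) 0))\<^sup>2)))"
proof -
  define u where "u = \<psi> (T + 1)"
  define v where "v = \<psi> T"
  define n where "n = real CARD('n)"
  have n: "n > 0" by (simp add: n_def)
  have sq: "(norm (u - translate e v))\<^sup>2 = (norm u)\<^sup>2 + (norm v)\<^sup>2 - 2 * (u \<bullet> translate e v)" for e
    using dot_norm_neg[of u "translate e v"] by simp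
  have "(\<Sum>j\<in>UNIV. (norm (u - translate (- axis j 1) v))\<^sup>2 + (norm (u - translate (axis j 1) v))\<^sup>2)
      = 2 * n * ((norm u)\<^sup>2 + (norm v)\<^sup>2) - 2 * (u \<bullet> (\<Sum>j\<in>UNIV. translate (axis j 1) v + translate (- axis j 1) v))"
    unfolding sq by (simp add: sum.distrib sum_subtractf inner_sum_right inner_add_right n_def
        sum_distrib_left[symmetric] algebra_simps)
  also have "(\<Sum>j\<in>UNIV. translate (axis j 1) v + translate (- axis j 1) v) = n *\<^sub>R average v"
    using n by (simp add: average_def n_def)
  finally have *: "(\<Sum>j\<in>UNIV. ((norm (u - translate (- axis j 1) v))\<^sup>2 + (norm (u - translate (axis j 1) v))\<^sup>2)
        / (4 * n * \<tau>\<^sup>2))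
      = ((norm u)\<^sup>2 + (norm v)\<^sup>2 - u \<bullet> average v) / (2 * \<tau>\<^sup>2)"
    using n \<tau> by (simp add: sum_divide_distrib[symmetric] field_simps)
  have "e * ((N - I) / (2 * \<tau>\<^sup>2) + m\<^sup>2 * (N / 4)) + e * (q / 4)
      = e / (2 * \<tau>\<^sup>2) * (a * N - I + \<tau>\<^sup>2 / 2 * q)" for e N I q :: real
    using \<tau> by (simp add: a_def field_simps)
  then show ?thesis
    unfolding energy_eq_norms u_def[symmetric] v_def[symmetric] n_def[symmetric] * .
qed

text \<open>Multiply the equation by the difference \<open>u - w\<close> of the new and the old slice. The average is
  self-adjoint, so the linear part telescopes in time, and the nonlinear part gives
  \<open>(s - t) * divdiff C p s t = W s - W t\<close>, the increment of the potential.\<close>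

lemma energy_conserved:
  fixes \<psi> :: "int \<Rightarrow> (int ^ 'n::finite) ell2"
  assumes "\<And>T. balanced (\<psi> (T + 1)) (\<psi> T) (\<psi> (T - 1))"
  shows "energy W m \<tau> \<epsilon> (\<lambda>T. coord (\<psi> T)) T = energy W m \<tau> \<epsilon> (\<lambda>T. coord (\<psi> T)) 0"
proof -
  have step: "energy W m \<tau> \<epsilon> (\<lambda>T. coord (\<psi> T)) T = energy W m \<tau> \<epsilon> (\<lambda>T. coord (\<psi> T)) (T - 1)" for T
  proof -
    define u where "u = \<psi> (T + 1)"
    define v where "v = \<psi> T"
    define w where "w = \<psi> (T - 1)"
    define s where "s = (cmod (coord u 0))\<^sup>2"
    define t where "t = (cmod (coord w 0))\<^sup>2"
    define b where "b = divdiff C p s t"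
    have "a *\<^sub>R (u + w) = average v - (\<tau>\<^sup>2 / 2 * b) *\<^sub>R delta 0 (coord (u + w) 0)"
      using assms[of T] by (simp only: balanced_def u_def v_def w_def s_def t_def b_def)
    then have "(u - w) \<bullet> (a *\<^sub>R (u + w)) = (u - w) \<bullet> average v
        - (\<tau>\<^sup>2 / 2 * b) * ((u - w) \<bullet> delta 0 (coord (u + w) 0))"
      by (simp add: inner_diff_right)
    moreover have "(u - w) \<bullet> delta 0 (coord (u + w) 0) = s - t"
      by (subst inner_ell2_delta[of 0])
        (simp_all add: delta.rep_eq coord_simps s_def t_def dot_square_norm[symmetric]
          inner_diff_left inner_add_right inner_commute[of "coord w 0" "coord u 0"])
    moreover have "(s - t) * b = W s - W t"
      by (simp add: b_def W_def divdiff_eq)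
    ultimately have "(u - w) \<bullet> (a *\<^sub>R (u + w)) = (u - w) \<bullet> average v - \<tau>\<^sup>2 / 2 * (W s - W t)"
      by (simp add: mult.commute)
    then have "a * ((norm u)\<^sup>2 - (norm w)\<^sup>2) = u \<bullet> average v - v \<bullet> average w - \<tau>\<^sup>2 / 2 * (W s - W t)"
      by (simp add: inner_diff_left inner_add_right inner_commute[of w u] inner_average[of v w, symmetric]
          inner_commute[of w "average v"] dot_square_norm)
    then show ?thesis
      unfolding energy_eq_inner diff_add_cancel u_def[symmetric] v_def[symmetric] w_def[symmetric]
        s_def[symmetric] t_def[symmetric]
      by (intro arg_cong2[where f = "(*)"] refl) (simp add: algebra_simps diff_divide_distrib)
  qed
  show ?thesis
  proof (induction T rule: int_induct[where k = 0])
    case (step1 i)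
    then show ?case using step[of "i + 1"] by simp
  next
    case (step2 i)
    then show ?case using step[of i] by simp
  qed simp
qed

lemma W_bdd_below: "bdd_below (W ` {0..})"
  unfolding W_def[abs_def] using polynomial_bounded_below[of C p] C by simp

text \<open>Drop the nonnegative difference terms and the mass term of one slice. The potential terms are
  at least \<open>\<epsilon> ^ CARD('n) / 2\<close> times the infimum of \<open>W\<close>; the infimum is at most \<open>W 0 = 0\<close>, so for
  \<open>\<epsilon> \<le> 1\<close> this is at least the infimum itself.\<close>

lemma norm_le_energy:
  fixes \<psi> :: "int \<Rightarrow> (int ^ 'n::finite) ell2"
  assumes \<epsilon>: "0 < \<epsilon>" "\<epsilon> \<le> 1"
  shows "\<epsilon> ^ CARD('n) * (norm (\<psi> T))\<^sup>2
    \<le> 4 / m\<^sup>2 * (energy W m \<tau> \<epsilon> (\<lambda>T. coord (\<psi> T)) T - (INF l\<in>{0..}. W l))"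
proof -
  define I where "I = (INF l\<in>{0..}. W l)"
  have I: "I \<le> W l" if "l \<ge> 0" for l
    unfolding I_def using that by (intro cINF_lower W_bdd_below) auto
  define e where "e = \<epsilon> ^ CARD('n)"
  have e: "0 < e" "e \<le> 1" using \<epsilon> by (auto simp: e_def power_le_one)
  have "I \<le> 0" using I[of 0] by (simp add: W_def)
  then have "I \<le> e * I" using e mult_right_mono_neg[of e 1 I] by simp
  also have "\<dots> \<le> e * ((W s + W t) / 2)" if "s \<ge> 0" "t \<ge> 0" for s t
    using I[of s] I[of t] that e by (intro mult_left_mono) auto
  finally have pot: "I \<le> e * ((W s + W t) / 4)" if "s \<ge> 0" "t \<ge> 0" for s t
    using that \<open>I \<le> 0\<close> by fastforce
  have "e * (m\<^sup>2 * ((norm (\<psi> T))\<^sup>2 / 4)) + I \<le> energy W m \<tau> \<epsilon> (\<lambda>T. coord (\<psi> T)) T"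
    unfolding energy_eq_norms e_def[symmetric]
    by (intro add_mono mult_left_mono pot add_increasing sum_nonneg) (use e in auto)
  then have "e * (norm (\<psi> T))\<^sup>2 * m\<^sup>2 \<le> 4 * (energy W m \<tau> \<epsilon> (\<lambda>T. coord (\<psi> T)) T - I)"
    by (simp add: algebra_simps)
  then show ?thesis
    using m unfolding I_def[symmetric] e_def[symmetric] by (simp add: field_simps)
qed

text \<open>The energy can be formed with any space step; here \<open>\<epsilon> = 1\<close>.\<close>

lemma bounded_of_balanced:
  fixes \<psi> :: "int \<Rightarrow> (int ^ 'n::finite) ell2"
  assumes "\<And>T. balanced (\<psi> (T + 1)) (\<psi> T) (\<psi> (T - 1))"
  shows "bounded (range \<psi>)"
proof -
  define M where "M = 4 / m\<^sup>2 * (energy W m \<tau> 1 (\<lambda>T. coord (\<psi> T)) 0 - (INF l\<in>{0..}. W l))"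
  have "norm (\<psi> T) \<le> sqrt M" for T
    using norm_le_energy[of 1 \<psi> T] energy_conserved[OF assms, of 1 T]
    by (intro real_le_rsqrt) (simp add: M_def)
  then show ?thesis by (auto simp: bounded_iff)
qed

end

section \<open>Norm continuity and weak continuity\<close>

lemma topspace_weak_topology [simp]: "topspace weak_topology = UNIV"
proof -
  have "phase_functional (\<lambda>_. 0)" by (simp add: phase_functional_def)
  then have "(\<lambda>_. 0) -` UNIV \<in> {f -` S |f S. phase_functional f \<and> open S}" by blast
  then show ?thesis by (auto simp: weak_topology_def)
qed

lemma phase_functional_weakly_continuous:
  assumes "phase_functional f"
  shows "continuous_map weak_topology euclidean f"
proof -
  have "openin weak_topology (f -` U)" if "open U" for U
    using assms that unfolding weak_topology_def by (intro topology_generated_by_Basis) blast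
  then show ?thesis by (simp add: continuous_map vimage_def)
qed

lemma weakly_continuousI:
  fixes g :: "'n::finite phase \<Rightarrow> 'n phase"
  assumes "\<And>f :: 'n phase \<Rightarrow> complex. phase_functional f \<Longrightarrow> continuous_map weak_topology euclidean (\<lambda>u. f (g u))"
  shows "continuous_map weak_topology weak_topology g"
proof -
  have "continuous_map weak_topology
      (topology_generated_by {f -` S |f S. phase_functional f \<and> open S}) g"
  proof (rule continuous_on_generated_topo)
    fix U :: "'n phase set"
    assume "U \<in> {f -` S |f S. phase_functional f \<and> open S}"
    then obtain f S where U: "U = f -` S" and f: "phase_functional f" and S: "open S" by blast
    from openin_continuous_map_preimage[OF assms[OF f], of S] S
    show "openin weak_topology (g -` U \<inter> topspace weak_topology)"
      by (simp add: U vimage_def)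
  next
    show "g ` topspace weak_topology \<subseteq> \<Union>{f -` S |f S. phase_functional f \<and> open S}"
      using topspace_weak_topology unfolding weak_topology_def topology_generated_by_topspace by blast
  qed
  then show ?thesis unfolding weak_topology_def .
qed

lemma continuous_map_euclidean_Pair:
  fixes f :: "'a \<Rightarrow> 'b::topological_space" and g :: "'a \<Rightarrow> 'c::topological_space"
  shows "continuous_map X euclidean f \<Longrightarrow> continuous_map X euclidean g
    \<Longrightarrow> continuous_map X euclidean (\<lambda>x. (f x, g x))"
  by (simp add: continuous_map_atin tendsto_Pair)

lemma weakly_continuous_linear:
  fixes L :: "'n::finite phase \<Rightarrow> 'n phase"
  assumes L: "bounded_linear L"
    and hom: "\<And>c u v. L (cscale c u, cscale c v) = (cscale c (fst (L (u, v))), cscale c (snd (L (u, v))))"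
  shows "continuous_map weak_topology weak_topology L"
proof (rule weakly_continuousI)
  fix f :: "'n phase \<Rightarrow> complex" assume f: "phase_functional f"
  have "phase_functional (\<lambda>u. f (L u))"
    unfolding phase_functional_def
  proof (intro conjI allI)
    show "bounded_linear (\<lambda>u. f (L u))"
      using bounded_linear_compose[of f L] f L by (simp add: phase_functional_def)
    show "f (L (cscale c u, cscale c v)) = c * f (L (u, v))" for c u v
      using f unfolding hom phase_functional_def by (metis prod.collapse)
  qed
  then show "continuous_map weak_topology euclidean (\<lambda>u. f (L u))"
    by (rule phase_functional_weakly_continuous)
qed

text \<open>A nonlinear perturbation whose values lie on a fixed complex line is weakly continuous as soon as
  its scalar coefficient is; composed with a functional it becomes that coefficient times a
  constant.\<close>

lemma weakly_continuous_add_rank_one: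
  fixes g :: "'n::finite phase \<Rightarrow> 'n phase"
  assumes g: "continuous_map weak_topology weak_topology g"
    and h: "continuous_map weak_topology euclidean h"
  shows "continuous_map weak_topology weak_topology (\<lambda>u. g u + (cscale (h u) x, cscale (h u) y))"
proof (rule weakly_continuousI)
  fix f :: "'n phase \<Rightarrow> complex" assume f: "phase_functional f"
  have "continuous_map weak_topology euclidean (\<lambda>u. f (g u))"
    using continuous_map_compose[OF g phase_functional_weakly_continuous[OF f]] by (simp add: o_def)
  then have "continuous_map weak_topology euclidean (\<lambda>u. (f (g u), h u))"
    using h by (rule continuous_map_euclidean_Pair)
  then have "continuous_map weak_topology euclidean ((\<lambda>(s, t). s + t * f (x, y)) \<circ> (\<lambda>u. (f (g u), h u)))"
    by (rule continuous_map_compose) (auto simp: case_prod_unfold intro!: continuous_intros)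
  moreover have "f (g u + (cscale (h u) x, cscale (h u) y)) = f (g u) + h u * f (x, y)" for u
    using f linear_add[OF bounded_linear.linear, of f] by (simp add: phase_functional_def)
  ultimately show "continuous_map weak_topology euclidean (\<lambda>u. f (g u + (cscale (h u) x, cscale (h u) y)))"
    by (simp add: o_def)
qed

lemma cscale_diff: "cscale c (u - v) = cscale c u - cscale c v"
  by (rule ell2_eqI) (simp add: coord_simps algebra_simps)

lemma cscale_scaleR: "cscale c (r *\<^sub>R u) = r *\<^sub>R cscale c u"
  by (rule ell2_eqI) (simp add: coord_simps)

context discrete_KG
begin

lemma continuous_next_slice:
  assumes f: "continuous_on A f" and g: "continuous_on A g"
  shows "continuous_on A (\<lambda>x. next_slice (f x) (g x))"
proof -
  note avg = bounded_linear.continuous_on[OF bounded_linear_average f]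
  note coords = bounded_linear.continuous_on[OF bounded_linear_coord g]
    bounded_linear.continuous_on[OF bounded_linear_coord avg]
  have "continuous_on A (\<lambda>x. S (coord (g x) 0) (coord (average (f x)) 0))"
    using continuous_on_compose2[OF S_cont continuous_on_Pair[OF coords]] by simp
  then have "continuous_on A (\<lambda>x. delta 0 (S (coord (g x) 0) (coord (average (f x)) 0)
      - coord (average (f x)) 0 / of_real a) :: (int ^ 'b) ell2)"
    using a_pos
    by (intro bounded_linear.continuous_on[OF bounded_linear_delta] continuous_on_diff
        continuous_on_divide continuous_on_const coords(2)) auto
  then show ?thesis
    unfolding next_slice_def by (intro continuous_intros avg g)
qed

lemma continuous_flow: "continuous_on UNIV (flow next_slice T)"
proof (induction rule: flow_induct)
  case 1
  show ?case by (simp add: id_def)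
next
  case (2 f)
  then show ?case
    unfolding o_def case_prod_unfold by (intro continuous_intros continuous_next_slice)
next
  case (3 f)
  then show ?case
    unfolding o_def case_prod_unfold by (intro continuous_intros continuous_next_slice)
qed

lemma weakly_continuous_swap: "continuous_map weak_topology weak_topology (\<lambda>u. (snd u, fst u))"
  by (rule weakly_continuous_linear)
    (simp_all add: bounded_linear_Pair bounded_linear_fst bounded_linear_snd)

text \<open>The step is a bounded linear map plus a multiple of the unit sequence at the origin, and the
  multiple is a continuous function of two numbers, each given by a continuous linear functional
  of the two slices.\<close>

lemma weakly_continuous_step:
  "continuous_map weak_topology weak_topology
    (\<lambda>(w, v). (v :: (int ^ 'n::finite) ell2, next_slice v w))"
proof -
  define L where "L u = (snd u, (1 / a) *\<^sub>R average (snd u) - fst u)" for u :: "'n phase"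
  define h where "h u = S (coord (fst u) 0) (coord (average (snd u)) 0) - coord (average (snd u)) 0 / of_real a"
    for u :: "'n phase"
  have coord_fst: "phase_functional (\<lambda>u :: 'n phase. coord (fst u) 0)"
    by (simp add: phase_functional_def coord_simps bounded_linear_compose[OF bounded_linear_coord bounded_linear_fst])
  have coord_avg: "phase_functional (\<lambda>u :: 'n phase. coord (average (snd u)) 0)"
    by (simp add: phase_functional_def coord_simps average_cscale
        bounded_linear_compose[OF bounded_linear_coord bounded_linear_compose[OF bounded_linear_average bounded_linear_snd]])
  have "continuous_map weak_topology euclidean (\<lambda>u :: 'n phase. (coord (fst u) 0, coord (average (snd u)) 0))"
    by (intro continuous_map_euclidean_Pair phase_functional_weakly_continuous coord_fst coord_avg)
  moreover have "continuous_on UNIV (\<lambda>x. S (fst x) (snd x) - snd x / of_real a)"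
    using S_cont a_pos unfolding case_prod_unfold
    by (intro continuous_on_diff continuous_on_divide continuous_on_const continuous_on_snd
        continuous_on_id) auto
  then have "continuous_map euclidean euclidean (\<lambda>x. S (fst x) (snd x) - snd x / of_real a)"
    by simp
  ultimately have "continuous_map weak_topology euclidean ((\<lambda>x. S (fst x) (snd x) - snd x / of_real a)
      \<circ> (\<lambda>u :: 'n phase. (coord (fst u) 0, coord (average (snd u)) 0)))"
    by (rule continuous_map_compose)
  then have h: "continuous_map weak_topology euclidean h"
    by (simp add: h_def[abs_def] o_def)
  have "bounded_linear L"
    unfolding L_def
    by (intro bounded_linear_Pair bounded_linear_sub bounded_linear_const_scaleR bounded_linear_fst
        bounded_linear_snd bounded_linear_compose[OF bounded_linear_average])
  then have "continuous_map weak_topology weak_topology L"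
    by (rule weakly_continuous_linear) (simp add: L_def average_cscale cscale_diff cscale_scaleR)
  from weakly_continuous_add_rank_one[OF this h, of 0 "delta 0 1"]
  have "continuous_map weak_topology weak_topology (\<lambda>u. L u + (cscale (h u) 0, cscale (h u) (delta 0 1)))" .
  also have "(\<lambda>u. L u + (cscale (h u) 0, cscale (h u) (delta 0 1))) = (\<lambda>(w, v). (v, next_slice v w))"
    by (auto simp: fun_eq_iff L_def h_def next_slice_def intro!: ell2_eqI)
      (simp_all add: coord_simps delta.rep_eq)
  finally show ?thesis .
qed

lemma weakly_continuous_flow: "continuous_map weak_topology weak_topology (flow next_slice T)"
proof (induction rule: flow_induct)
  case 1
  show ?case by simp
next
  case (2 f)
  then show ?case by (rule continuous_map_compose[OF _ weakly_continuous_step])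
next
  case (3 f)
  have eq: "(\<lambda>(w, v). (next_slice w v, w)) = (\<lambda>u. (snd u, fst u)) \<circ> (\<lambda>(w, v). (v, next_slice v w)) \<circ> (\<lambda>u. (snd u, fst u))"
    by (auto simp: fun_eq_iff)
  show ?case
    unfolding eq
    by (rule continuous_map_compose[OF 3 continuous_map_compose[OF weakly_continuous_swap
          continuous_map_compose[OF weakly_continuous_step weakly_continuous_swap]]])
qed

end

section \<open>The Cauchy problem\<close>

context discrete_KG
begin

lemma cauchy_solution_iff:
  "cauchy_solution W m \<tau> u \<psi> \<longleftrightarrow> \<psi> = (\<lambda>T. fst (flow next_slice T u))"
proof -
  have "cauchy_solution W m \<tau> u \<psi> \<longleftrightarrow> (\<psi> 0, \<psi> 1) = u \<and> (\<forall>T. \<psi> (T + 1) = next_slice (\<psi> T) (\<psi> (T - 1)))"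
    using bounded_of_balanced[of \<psi>] by (auto simp: cauchy_solution_def KG_iff balanced_iff_next_slice)
  then show ?thesis using recurrence_iff_flow[of next_slice, OF next_slice_involutive] by metis
qed

lemma propagator_eq_flow: "propagator W m \<tau> T = flow next_slice T"
proof
  fix u :: "'n::finite phase"
  show "propagator W m \<tau> T u = flow next_slice T u"
    by (simp add: propagator_def cauchy_solution_iff flow_add_one[of next_slice, OF next_slice_involutive]
        split: prod.splits)
qed

end

text \<open>The linear part of the equation at the origin contributes at least 1 to the radial slope, and the
  nonlinear part at least \<open>- \<tau>\<^sup>2 * K / 2\<close> with the constant \<open>K\<close> of the key estimate. For
  \<open>\<tau> < 1 / (1 + K)\<close> both \<open>\<tau>\<close> and \<open>\<tau> * K\<close> are at most 1, so the slope is at least one half.\<close>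

lemma exists_discrete_KG:
  fixes C :: "nat \<Rightarrow> real"
  assumes m: "m > 0" and p: "p \<ge> 1" and C: "C p > 0"
  shows "\<exists>\<tau>0>0. \<forall>\<tau>. 0 < \<tau> \<and> \<tau> < \<tau>0 \<longrightarrow> (\<exists>S. discrete_KG C p m \<tau> S)"
proof -
  obtain K where K: "K \<ge> 0" "\<And>r \<omega> z. cmod \<omega> = 1 \<Longrightarrow>
    \<exists>d\<ge>- K. ((\<lambda>r. r * divdiff C p ((cmod (of_real r * \<omega> - z))\<^sup>2) ((cmod z)\<^sup>2))
      has_real_derivative d) (at r)"
    using radial_divdiff_derivative_bounded_below[of C p] C p by blast
  show ?thesis
  proof (intro exI[of _ "1 / (1 + K)"] conjI allI impI)
    show "1 / (1 + K) > 0" using K by simp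
    fix \<tau> :: real assume \<tau>: "0 < \<tau> \<and> \<tau> < 1 / (1 + K)"
    then have "\<tau> * (1 + K) < 1" using K by (simp add: field_simps)
    moreover have "\<tau> * K \<ge> 0" using \<tau> K by simp
    ultimately have "\<tau> \<le> 1" "\<tau> * K \<le> 1" using \<tau> by (simp_all add: algebra_simps)
    then have \<tau>K: "\<tau>\<^sup>2 * K \<le> 1"
      using \<tau> \<open>\<tau> * K \<ge> 0\<close> mult_mono[of \<tau> 1 "\<tau> * K" 1] by (simp add: power2_eq_square mult.assoc)
    define \<kappa> where "\<kappa> w z = 1 + \<tau>\<^sup>2 * m\<^sup>2 / 2 + \<tau>\<^sup>2 / 2 * divdiff C p ((cmod (w - z))\<^sup>2) ((cmod z)\<^sup>2)" for w z
    have "\<exists>S. continuous_on UNIV (\<lambda>(z, g). S z g) \<and> (\<forall>w z g. of_real (\<kappa> w z) * w = g \<longleftrightarrow> w = S z g)"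
    proof (rule radial_map_continuous_inverse)
      show "continuous_on UNIV (\<lambda>(w, z). \<kappa> w z)"
        unfolding \<kappa>_def case_prod_unfold by (intro continuous_intros)
      fix r :: real and \<omega> z :: complex
      assume "cmod \<omega> = 1"
      then obtain d where d: "d \<ge> - K" "((\<lambda>r. r * divdiff C p ((cmod (of_real r * \<omega> - z))\<^sup>2) ((cmod z)\<^sup>2))
          has_real_derivative d) (at r)"
        using K(2) by blast
      have radial: "(\<lambda>r. r * \<kappa> (of_real r * \<omega>) z) = (\<lambda>r. (1 + \<tau>\<^sup>2 * m\<^sup>2 / 2) * r
          + \<tau>\<^sup>2 / 2 * (r * divdiff C p ((cmod (of_real r * \<omega> - z))\<^sup>2) ((cmod z)\<^sup>2)))"
        by (simp add: \<kappa>_def fun_eq_iff algebra_simps)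
      have "((\<lambda>r. (1 + \<tau>\<^sup>2 * m\<^sup>2 / 2) * r + \<tau>\<^sup>2 / 2 * (r * divdiff C p ((cmod (of_real r * \<omega> - z))\<^sup>2) ((cmod z)\<^sup>2)))
          has_real_derivative (1 + \<tau>\<^sup>2 * m\<^sup>2 / 2) * 1 + \<tau>\<^sup>2 / 2 * d) (at r)"
        by (intro DERIV_add DERIV_cmult DERIV_ident d(2))
      moreover have "- (\<tau>\<^sup>2 * K) \<le> \<tau>\<^sup>2 * d"
        using mult_left_mono[OF d(1), of "\<tau>\<^sup>2"] by simp
      then have "1 / 2 \<le> 1 + \<tau>\<^sup>2 * m\<^sup>2 / 2 + \<tau>\<^sup>2 * d / 2"
        using \<tau>K mult_nonneg_nonneg[OF zero_le_power2 zero_le_power2, of \<tau> m] by linarith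
      then have "1 / 2 \<le> (1 + \<tau>\<^sup>2 * m\<^sup>2 / 2) * 1 + \<tau>\<^sup>2 / 2 * d" by simp
      ultimately show "\<exists>d\<ge>1 / 2. ((\<lambda>r. r * \<kappa> (of_real r * \<omega>) z) has_real_derivative d) (at r)"
        unfolding radial by blast
    qed
    then show "\<exists>S. discrete_KG C p m \<tau> S"
      using \<tau> m C unfolding discrete_KG_def \<kappa>_def by blast
  qed
qed

theorem theorem2p7:
  fixes m :: real and C :: "nat \<Rightarrow> real" and p :: nat and W :: "real \<Rightarrow> real"
  assumes m: "m > 0"
    and p: "p \<ge> 1"
    and C: "C p > 0"
    and W: "\<And>l. W l = (\<Sum>q=0..p. C q * l ^ (q + 1))"
  shows "\<exists>\<tau>0>0. \<forall>\<tau> \<epsilon>. 0 < \<tau> \<and> \<tau> < \<tau>0 \<and> \<epsilon> = sqrt (real CARD('n::finite)) * \<tau> \<longrightarrow>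
    (\<forall>u :: 'n phase. \<exists>!\<psi>. cauchy_solution W m \<tau> u \<psi>) \<and>
    (\<forall>(u :: 'n phase) \<psi>. cauchy_solution W m \<tau> u \<psi> \<longrightarrow>
      (\<forall>T. energy W m \<tau> \<epsilon> (\<lambda>T. coord (\<psi> T)) T = energy W m \<tau> \<epsilon> (\<lambda>T. coord (\<psi> T)) 0) \<and>
      (\<forall>T. \<epsilon> ^ CARD('n) * (norm (\<psi> T))\<^sup>2
        \<le> 4 / m\<^sup>2 * (energy W m \<tau> \<epsilon> (\<lambda>T. coord (\<psi> T)) 0 - (INF l\<in>{0..}. W l)))) \<and>
    (\<forall>T. continuous_on UNIV (propagator W m \<tau> T :: 'n phase \<Rightarrow> 'n phase)) \<and>
    (\<forall>T. continuous_map weak_topology weak_topology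
      (propagator W m \<tau> T :: 'n phase \<Rightarrow> 'n phase))"
proof -
  obtain \<tau>1 where \<tau>1: "\<tau>1 > 0" "\<And>\<tau>. 0 < \<tau> \<Longrightarrow> \<tau> < \<tau>1 \<Longrightarrow> \<exists>S. discrete_KG C p m \<tau> S"
    using exists_discrete_KG[of m p C] m p C by blast
  \<comment> \<open>The second bound makes the space step at most 1, as the a priori estimate requires.\<close>
  define \<tau>0 where "\<tau>0 = min \<tau>1 (1 / sqrt (real CARD('n)))"
  have "\<tau>0 > 0" using \<tau>1 by (simp add: \<tau>0_def)
  then show ?thesis
  proof (intro exI[of _ \<tau>0] conjI[OF \<open>\<tau>0 > 0\<close>] allI impI, elim conjE, goal_cases)
    case (1 \<tau> \<epsilon>)
    obtain S where "discrete_KG C p m \<tau> S"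
      using \<tau>1(2)[of \<tau>] 1 by (auto simp: \<tau>0_def)
    then interpret kg: discrete_KG C p m \<tau> S .
    have W_eq: "W = kg.W" by (simp add: fun_eq_iff W kg.W_def)
    have \<epsilon>: "0 < \<epsilon>" "\<epsilon> \<le> 1" using 1 by (simp_all add: \<tau>0_def field_simps)
    have bal: "kg.balanced (\<psi> (T + 1)) (\<psi> T) (\<psi> (T - 1))"
      if "cauchy_solution W m \<tau> u \<psi>" for u :: "'n phase" and \<psi> T
      using that by (simp add: W_eq cauchy_solution_def kg.KG_iff)
    show ?case
    proof (intro conjI allI impI)
      show "\<exists>!\<psi>. cauchy_solution W m \<tau> u \<psi>" for u :: "'n phase"
        by (simp add: W_eq kg.cauchy_solution_iff)
    next
      fix u :: "'n phase" and \<psi> T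
      assume sol: "cauchy_solution W m \<tau> u \<psi>"
      show "energy W m \<tau> \<epsilon> (\<lambda>T. coord (\<psi> T)) T = energy W m \<tau> \<epsilon> (\<lambda>T. coord (\<psi> T)) 0"
        unfolding W_eq by (rule kg.energy_conserved[OF bal[OF sol]])
      then show "\<epsilon> ^ CARD('n) * (norm (\<psi> T))\<^sup>2
          \<le> 4 / m\<^sup>2 * (energy W m \<tau> \<epsilon> (\<lambda>T. coord (\<psi> T)) 0 - (INF l\<in>{0..}. W l))"
        using kg.norm_le_energy[OF \<epsilon>, of \<psi> T] unfolding W_eq by (simp only:)
    next
      show "continuous_on UNIV (propagator W m \<tau> T :: 'n phase \<Rightarrow> 'n phase)" for T
        by (simp add: W_eq kg.propagator_eq_flow kg.continuous_flow)
      show "continuous_map weak_topology weak_topology (propagator W m \<tau> T :: 'n phase \<Rightarrow> 'n phase)" for T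
        by (simp add: W_eq kg.propagator_eq_flow kg.weakly_continuous_flow)
    qed
  qed
qed

end
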